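(* For the finite-level open quantum memory system described in the context, at any time $t\geqslant 0$ the mean-square deviation $\Delta(t)=\mathbf{E}(\eta(t)^{\mathrm T}\eta(t))$ is an affine function $$\Delta(t)=\langle R,z(t)\rangle+d=\langle R,z(t)-z_0\rangle$$ of the matrix $z(t)=\begin{bmatrix}\mu(t)& P+Q(t)\end{bmatrix}\in\mathbb{R}^{n\times(n+1)}$, where $R=\begin{bmatrix}\sigma&-2\Sigma\end{bmatrix}$, $\sigma=(\langle\Sigma,\gamma_\ell\rangle)_{1\leqslant\ell\leqslant n}$, $d=2\langle\Sigma,P\rangle-\sigma^{\mathrm T}\mu_0$, and $z_0=z(0)=\begin{bmatrix}\mu_0&P\end{bmatrix}$. The matrix $z$ satisfies the nonhomogeneous linear ODE $$\dot z(t)=A(t)z(t)+c,\qquad c:=b\begin{bmatrix}1&\mu_0^{\mathrm T}\end{bmatrix}\in\mathbb{R}^{n\times(n+1)},$$ with the initial condition $z(0)=z_0$.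
   Context: Conventions. For an array $T=(T_{jk\ell})\in\mathbb{C}^{p\times q\times s}$ with sections $T_\ell:=(T_{jk\ell})_{j,k}\in\mathbb{C}^{p\times q}$ and a vector $w$ of $s$ entries (numbers or operators), $T\cdot w:=\sum_{\ell=1}^s T_\ell w_\ell$; also $T_{\ell\bullet\bullet}:=(T_{\ell jk})_{j,k}$. For $T\in\mathbb{R}^{n\times n\times n}$ and $u\in\mathbb{R}^n$, $T\diamond u:=\begin{bmatrix}T_1u&\ldots&T_nu\end{bmatrix}$. $\mathrm{vec}$ is column-stacking vectorization, $\langle\cdot,\cdot\rangle$ is the Frobenius inner product of real matrices, $[\xi,\eta]=\xi\eta-\eta\xi$, and operators and expectations act entrywise on vectors and matrices of operators. System. Let $\mathfrak{H}:=\mathfrak{H}_0\otimes\mathfrak{F}$, where $\mathfrak{H}_0$ is a finite-dimensional complex Hilbert space and $\mathfrak{F}$ is a symmetric Fock space carrying a quantum Wiener process $W=(W_k)_{1\leqslant k\leqslant m}$ ($m$ even) of self-adjoint operators with Ito table $\mathrm{d}W\mathrm{d}W^{\mathrm T}=(I_m+iJ)\mathrm{d}t$, $J:=I_{m/2}\otimes\begin{bmatrix}0&1\\-1&0\end{bmatrix}$, and $[W(s),W(t)^{\mathrm T}]=2i\min(s,t)J$. The state on $\mathfrak H$ is $\rho=\rho_0\otimes\upsilon$, with $\rho_0$ a density operator on $\mathfrak{H}_0$ and $\upsilon$ the vacuum state on $\mathfrak{F}$; $\mathbf{E}\zeta:=\mathrm{Tr}(\rho\zeta)$. The vector $X(t)=(X_k(t))_{1\leqslant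 k\leqslant n}$ of self-adjoint system variables on $\mathfrak{H}$ has initial value $X_0:=X(0)$ consisting of Hermitian operators on $\mathfrak{H}_0$ (extended to $\mathfrak H$ by tensoring with the identity) and satisfies for all $t\geqslant0$ the algebraic relations $$X(t)X(t)^{\mathrm T}=\alpha+\beta\cdot X(t),$$ where $\alpha=\alpha^{\mathrm T}\in\mathbb{R}^{n\times n}$ and $\beta\in\mathbb{C}^{n\times n\times n}$ has Hermitian sections $\beta_\ell$ (constants are identified with multiples of the identity operator). Put $\Theta:=\mathrm{Im}\,\beta=(\theta_{jk\ell})$ with sections $\Theta_\ell$, and $\gamma:=\mathrm{Re}\,\beta$ with sections $\gamma_\ell$. The control $U=(U_k)_{1\leqslant k\leqslant r}$ is a sufficiently smooth deterministic $\mathbb{R}^r$-valued function of time. The Hamiltonian is $(E_*+KU)^{\mathrm T}X$ with constant $E_*\in\mathbb{R}^n$, $K\in\mathbb{R}^{n\times r}$ (columns $K_1,\ldots,K_r$), and the system-field coupling operators are $MX+N$ with $M\in\mathbb{R}^{m\times n}$, $N\in\mathbb{R}^m$. The system variables obey the Hudson-Parthasarathy quantum stochastic differential equation $$\mathrm{d}X=(AX+b)\mathrm{d}t+2(\Theta\cdot X)M^{\mathrm T}\mathrm{d}W,$$ where $b:=2\begin{bmatrix}\Theta_1&\ldots&\Theta_n\end{bmatrix}\mathrm{vec}(M^{\mathrm T}JM\alpha)$, $A(t):=A_*+\mathcal{A}\cdot U(t)$, $\mathcal{A}\in\mathbb{R}^{n\times n\times r}$ has sections $A_k:=2\Theta\diamond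 K_k$, and $$A_*:=2\Theta\diamond(E_*+M^{\mathrm T}JN)+2\sum_{\ell=1}^n\Theta_\ell M^{\mathrm T}(M\theta_{\ell\bullet\bullet}+JM\,\mathrm{Re}\,\beta_{\ell\bullet\bullet}).$$ Derived quantities. $\mu(t):=\mathbf{E}X(t)$, $\mu_0:=\mu(0)$. $P:=\mathrm{Re}\,\mathbf{E}(X_0X_0^{\mathrm T})=\alpha+\gamma\cdot\mu_0$. $\xi(t):=X(t)-X_0$ and $Q(t):=\mathrm{Re}\,\mathbf{E}(\xi(t)X_0^{\mathrm T})$. For a given matrix $F\in\mathbb{R}^{\nu\times n}$ of full row rank ($\nu\leqslant n$), $\eta(t):=F\xi(t)$ is the deviation of $\varphi(t):=FX(t)$ from its initial value, and $\Sigma:=F^{\mathrm T}F$. *)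

theory Defs
  imports "HOL-Analysis.Analysis"
begin

section \<open>Complex Hilbert spaces and operators\<close>

class complex_hilbert = real_inner + complete_space +
  fixes scaleC :: "complex \<Rightarrow> 'a \<Rightarrow> 'a"  (infixr \<open>*\<^sub>C\<close> 75)
    and cinner :: "'a \<Rightarrow> 'a \<Rightarrow> complex"  \<comment> \<open>conjugate-linear in the first argument\<close>
  assumes scaleC_add_right: "a *\<^sub>C (x + y) = a *\<^sub>C x + a *\<^sub>C y"
    and scaleC_add_left: "(a + b) *\<^sub>C x = a *\<^sub>C x + b *\<^sub>C x"
    and scaleC_scaleC: "a *\<^sub>C b *\<^sub>C x = (a * b) *\<^sub>C x"
    and scaleC_of_real: "of_real r *\<^sub>C x = r *\<^sub>R x"
    and cinner_commute: "cinner x y = cnj (cinner y x)"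
    and cinner_add_right: "cinner x (y + z) = cinner x y + cinner x z"
    and cinner_scaleC_right: "cinner x (a *\<^sub>C y) = a * cinner x y"
    and Re_cinner: "Re (cinner x y) = x \<bullet> y"

definition cspan :: "'a::complex_hilbert set \<Rightarrow> 'a set"
  where "cspan S = span {c *\<^sub>C x | c x. x \<in> S}"

definition finite_cdim :: "'a::complex_hilbert itself \<Rightarrow> bool"
  where "finite_cdim _ \<longleftrightarrow> (\<exists>B :: 'a set. finite B \<and> cspan B = UNIV)"

definition bounded_clinear :: "('a::complex_hilbert \<Rightarrow> 'b::complex_hilbert) \<Rightarrow> bool"
  where "bounded_clinear T \<longleftrightarrow> bounded_linear T \<and> (\<forall>c x. T (c *\<^sub>C x) = c *\<^sub>C T x)"

definition selfadjoint :: "('a::complex_hilbert \<Rightarrow> 'a) \<Rightarrow> bool"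
  where "selfadjoint T \<longleftrightarrow> bounded_clinear T \<and> (\<forall>x y. cinner (T x) y = cinner x (T y))"

text \<open>An unbounded operator is a partial function. The second conjunct says that it coincides
  with its adjoint, domains included; linearity and closedness follow.\<close>

definition selfadjoint_unbounded :: "('a::complex_hilbert \<rightharpoonup> 'a) \<Rightarrow> bool"
  where "selfadjoint_unbounded T \<longleftrightarrow> closure (dom T) = UNIV \<and>
    (\<forall>y w. T y = Some w \<longleftrightarrow> (\<forall>x\<in>dom T. cinner w x = cinner y (the (T x))))"

definition orthonormal_basis :: "'a::complex_hilbert set \<Rightarrow> bool"
  where "orthonormal_basis B \<longleftrightarrow>
    (\<forall>x\<in>B. \<forall>y\<in>B. cinner x y = (if x = y then 1 else 0)) \<and> closure (cspan B) = UNIV"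

definition trace_op :: "('a::complex_hilbert \<Rightarrow> 'a) \<Rightarrow> complex"
  where "trace_op T = (\<Sum>\<^sub>\<infinity>x\<in>(SOME B. orthonormal_basis B). cinner x (T x))"

definition density_operator :: "('a::complex_hilbert \<Rightarrow> 'a) \<Rightarrow> bool"
  where "density_operator \<rho> \<longleftrightarrow>
    selfadjoint \<rho> \<and> (\<forall>x. 0 \<le> Re (cinner x (\<rho> x))) \<and> trace_op \<rho> = 1"

definition expectation :: "('a::complex_hilbert \<Rightarrow> 'a) \<Rightarrow> ('a \<Rightarrow> 'a) \<Rightarrow> complex"
  where "expectation \<rho> \<zeta> = trace_op (\<rho> \<circ> \<zeta>)"


section \<open>Tensor products and symmetric Fock space\<close>

text \<open>The Hilbert space tensor product is determined up to unitary equivalence by the following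
  property of its canonical map.\<close>

definition hilbert_tensor ::
    "('a::complex_hilbert \<Rightarrow> 'b::complex_hilbert \<Rightarrow> 'h::complex_hilbert) \<Rightarrow> bool"
  where "hilbert_tensor ten \<longleftrightarrow>
    (\<forall>u v x. ten (u + v) x = ten u x + ten v x) \<and>
    (\<forall>c u x. ten (c *\<^sub>C u) x = c *\<^sub>C ten u x) \<and>
    (\<forall>u x y. ten u (x + y) = ten u x + ten u y) \<and>
    (\<forall>c u x. ten u (c *\<^sub>C x) = c *\<^sub>C ten u x) \<and>
    (\<forall>u x v y. cinner (ten u x) (ten v y) = cinner u v * cinner x y) \<and>
    closure (cspan {ten u x | u x. True}) = UNIV"

text \<open>\<open>T\<close> is the operator \<open>S \<otimes> R\<close>; it is uniquely determined by this.\<close>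

definition is_tensor_op ::
    "('a::complex_hilbert \<Rightarrow> 'b::complex_hilbert \<Rightarrow> 'h::complex_hilbert) \<Rightarrow>
     ('a \<Rightarrow> 'a) \<Rightarrow> ('b \<Rightarrow> 'b) \<Rightarrow> ('h \<Rightarrow> 'h) \<Rightarrow> bool"
  where "is_tensor_op ten S R T \<longleftrightarrow>
    bounded_clinear T \<and> (\<forall>u x. T (ten u x) = ten (S u) (R x))"

text \<open>Square-integrable functions from the half-line to \<open>\<complex>\<close>-vectors indexed by \<open>'c\<close>; functions
  rather than classes of functions are used, and values at negative times are irrelevant.\<close>

definition L2 :: "(real \<Rightarrow> complex ^ 'c) set"
  where "L2 = {f. f \<in> borel_measurable (lebesgue_on {0..}) \<and>
                  integrable (lebesgue_on {0..}) (\<lambda>s. (norm (f s))\<^sup>2)}"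

definition L2_inner :: "(real \<Rightarrow> complex ^ 'c) \<Rightarrow> (real \<Rightarrow> complex ^ 'c) \<Rightarrow> complex"
  where "L2_inner f g = (LINT s|lebesgue_on {0..}. (\<Sum>j\<in>UNIV. cnj (f s $ j) * g s $ j))"

text \<open>The symmetric Fock space over that \<open>L\<^sup>2\<close> space, given (up to unitary equivalence, after Hudson
  and Parthasarathy) by its exponential vectors \<open>e f\<close>, i.e. the vectors with \<open>n\<close>-particle
  components \<open>f\<^sup>\<otimes>\<^sup>n / sqrt (n!)\<close>. The vacuum vector is \<open>e 0\<close>.\<close>

definition symmetric_fock_space ::
    "((real \<Rightarrow> complex ^ 'c) \<Rightarrow> 'f::complex_hilbert) \<Rightarrow> bool"
  where "symmetric_fock_space e \<longleftrightarrow>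
    (\<forall>f\<in>L2. \<forall>g\<in>L2. cinner (e f) (e g) = exp (L2_inner f g)) \<and>
    closure (cspan (e ` L2)) = UNIV"

definition vacuum_state ::
    "((real \<Rightarrow> complex ^ 'c) \<Rightarrow> 'f::complex_hilbert) \<Rightarrow> 'f \<Rightarrow> 'f"
  where "vacuum_state e x = cinner (e (\<lambda>_. 0)) x *\<^sub>C e (\<lambda>_. 0)"


section \<open>Quantum Wiener process and quantum stochastic integrals\<close>

text \<open>The index set of the Wiener process consists of pairs, so that its cardinality
  \<open>m = 2 * CARD('c)\<close> is even and \<open>I \<otimes> [[0, 1], [-1, 0]]\<close> has the following entries.\<close>

definition J_mat :: "real ^ ('c::finite \<times> 2) ^ ('c \<times> 2)"
  where "J_mat = (\<chi> p q. if fst p = fst q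
      then (vector [vector [0, 1], vector [-1, 0]] :: real ^ 2 ^ 2) $ snd p $ snd q else 0)"

text \<open>With \<open>g\<close> the indicator of \<open>[0, t]\<close> in channel \<open>j\<close>, the annihilation operator \<open>a(g)\<close> multiplies
  \<open>e f\<close> by \<open>\<langle>g, f\<rangle>\<close> and the creation operator sends it to the derivative of \<open>e (f + \<epsilon> g)\<close> at
  \<open>\<epsilon> = 0\<close>. The two quadratures are \<open>a + a\<^sup>*\<close> and \<open>-i (a - a\<^sup>*)\<close>, which gives the Ito table
  \<open>dW dW\<^sup>T = (I + i J) dt\<close> and \<open>[W(s), W(t)\<^sup>T] = 2 i min(s, t) J\<close>. The exponential vectors span a
  core, so \<open>W\<close> is determined.\<close>

definition channel_indicator :: "'c::finite \<Rightarrow> real \<Rightarrow> real \<Rightarrow> complex ^ 'c"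
  where "channel_indicator j t s = (if 0 \<le> s \<and> s \<le> t then axis j 1 else 0)"

definition quantum_wiener_process ::
    "((real \<Rightarrow> complex ^ 'c) \<Rightarrow> 'f::complex_hilbert) \<Rightarrow>
     ('c::finite \<times> 2 \<Rightarrow> real \<Rightarrow> 'f \<rightharpoonup> 'f) \<Rightarrow> bool"
  where "quantum_wiener_process e W \<longleftrightarrow>
    (\<forall>k. \<forall>t\<ge>0. selfadjoint_unbounded (W k t)) \<and>
    (\<forall>j. \<forall>t\<ge>0. \<forall>f\<in>L2. \<exists>cr.
       ((\<lambda>\<epsilon>. e (\<lambda>s. f s + \<epsilon> *\<^sub>R channel_indicator j t s)) has_vector_derivative cr) (at 0) \<and>
       (let an = L2_inner (channel_indicator j t) f *\<^sub>C e f in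
         W (j, 1) t (e f) = Some (an + cr) \<and>
         W (j, 2) t (e f) = Some ((- \<i>) *\<^sub>C (an - cr))))"

definition past :: "real \<Rightarrow> (real \<Rightarrow> complex ^ 'c) \<Rightarrow> real \<Rightarrow> complex ^ 'c"
  where "past t f s = (if s \<le> t then f s else 0)"

definition future :: "real \<Rightarrow> (real \<Rightarrow> complex ^ 'c) \<Rightarrow> real \<Rightarrow> complex ^ 'c"
  where "future t f s = (if s \<le> t then 0 else f s)"

text \<open>\<open>T\<close> is of the form \<open>T' \<otimes> I\<close> with respect to the splitting of the space into the part up to
  time \<open>t\<close> and the Fock space after \<open>t\<close>, under which \<open>u \<otimes> e f\<close> corresponds to
  \<open>(u \<otimes> e (past t f)) \<otimes> e (future t f)\<close>; stated in terms of matrix elements.\<close>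

definition adapted_op ::
    "('a::complex_hilbert \<Rightarrow> 'f::complex_hilbert \<Rightarrow> 'h::complex_hilbert) \<Rightarrow>
     ((real \<Rightarrow> complex ^ 'c) \<Rightarrow> 'f) \<Rightarrow> real \<Rightarrow> ('h \<Rightarrow> 'h) \<Rightarrow> bool"
  where "adapted_op ten e t T \<longleftrightarrow> bounded_clinear T \<and>
    (\<forall>u v. \<forall>f\<in>L2. \<forall>g\<in>L2.
      cinner (ten u (e f)) (T (ten v (e g))) =
      cinner (ten u (e (past t f))) (T (ten v (e (past t g)))) *
      cinner (e (future t f)) (e (future t g)))"

text \<open>The triple \<open>(N, \<tau>, E)\<close> stands for the process that equals \<open>E i\<close> on \<open>[\<tau> i, \<tau> (i + 1))\<close> for
  \<open>i < N\<close> and vanishes elsewhere.\<close>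

type_synonym 'h step_process = "nat \<times> (nat \<Rightarrow> real) \<times> (nat \<Rightarrow> 'h \<Rightarrow> 'h)"

fun step_adapted ::
    "('a::complex_hilbert \<Rightarrow> 'f::complex_hilbert \<Rightarrow> 'h::complex_hilbert) \<Rightarrow>
     ((real \<Rightarrow> complex ^ 'c) \<Rightarrow> 'f) \<Rightarrow> 'h step_process \<Rightarrow> bool"
  where "step_adapted ten e (N, \<tau>, E) \<longleftrightarrow>
    0 \<le> \<tau> 0 \<and> (\<forall>i<N. \<tau> i < \<tau> (Suc i) \<and> adapted_op ten e (\<tau> i) (E i))"

fun step_value :: "'h::complex_hilbert step_process \<Rightarrow> real \<Rightarrow> 'h \<Rightarrow> 'h"
  where "step_value (N, \<tau>, E) s \<psi> = (\<Sum>i<N. if \<tau> i \<le> s \<and> s < \<tau> (Suc i) then E i \<psi> else 0)"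

text \<open>The integral of a step process over \<open>[0, t]\<close> against \<open>V\<close>, evaluated at \<open>u \<otimes> x\<close>.\<close>

fun step_integral ::
    "('a::complex_hilbert \<Rightarrow> 'f::complex_hilbert \<Rightarrow> 'h::complex_hilbert) \<Rightarrow>
     (real \<Rightarrow> 'f \<rightharpoonup> 'f) \<Rightarrow> real \<Rightarrow> 'h step_process \<Rightarrow> 'a \<Rightarrow> 'f \<Rightarrow> 'h"
  where "step_integral ten V t (N, \<tau>, E) u x =
    (\<Sum>i<N. E i (ten u (the (V (min t (\<tau> (Suc i))) x) - the (V (min t (\<tau> i)) x))))"

text \<open>\<open>I\<close> is the integral of \<open>G dV\<close> over \<open>[0, t]\<close> on the exponential domain in the sense of Hudson and
  Parthasarathy: a strong limit of integrals of adapted step processes approximating \<open>G\<close> in mean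
  square.\<close>

definition has_qs_integral ::
    "('a::complex_hilbert \<Rightarrow> 'f::complex_hilbert \<Rightarrow> 'h::complex_hilbert) \<Rightarrow>
     ((real \<Rightarrow> complex ^ 'c) \<Rightarrow> 'f) \<Rightarrow>
     (real \<Rightarrow> 'f \<rightharpoonup> 'f) \<Rightarrow> (real \<Rightarrow> 'h \<Rightarrow> 'h) \<Rightarrow> real \<Rightarrow> ('h \<Rightarrow> 'h) \<Rightarrow> bool"
  where "has_qs_integral ten e V G t I \<longleftrightarrow>
    (\<exists>S :: nat \<Rightarrow> 'h step_process. (\<forall>n. step_adapted ten e (S n)) \<and>
      (\<forall>u. \<forall>f\<in>L2. let \<psi> = ten u (e f) in
        (\<forall>n. set_integrable lborel {0..t} (\<lambda>s. (norm (step_value (S n) s \<psi> - G s \<psi>))\<^sup>2)) \<and>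
        (\<lambda>n. LINT s:{0..t}|lborel. (norm (step_value (S n) s \<psi> - G s \<psi>))\<^sup>2) \<longlonglongrightarrow> 0 \<and>
        (\<lambda>n. step_integral ten V t (S n) u (e f)) \<longlonglongrightarrow> I \<psi>))"

text \<open>\<open>X\<close> is an adapted process with \<open>dX = D dt + G dW\<close> for vector \<open>D\<close> and matrix \<open>G\<close> of operators.\<close>

definition qsde ::
    "('a::complex_hilbert \<Rightarrow> 'f::complex_hilbert \<Rightarrow> 'h::complex_hilbert) \<Rightarrow>
     ((real \<Rightarrow> complex ^ 'c) \<Rightarrow> 'f) \<Rightarrow>
     ('c::finite \<times> 2 \<Rightarrow> real \<Rightarrow> 'f \<rightharpoonup> 'f) \<Rightarrow>
     (real \<Rightarrow> 'n \<Rightarrow> 'h \<Rightarrow> 'h) \<Rightarrow> (real \<Rightarrow> 'n \<Rightarrow> 'c \<times> 2 \<Rightarrow> 'h \<Rightarrow> 'h) \<Rightarrow>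
     (real \<Rightarrow> 'n \<Rightarrow> 'h \<Rightarrow> 'h) \<Rightarrow> bool"
  where "qsde ten e W D G X \<longleftrightarrow>
    (\<forall>t\<ge>0. \<forall>j. adapted_op ten e t (X t j)) \<and>
    (\<forall>t\<ge>0. \<forall>j. \<exists>I.
      (\<forall>k. has_qs_integral ten e (W k) (\<lambda>s. G s j k) t (I k)) \<and>
      (\<forall>u. \<forall>f\<in>L2. let \<psi> = ten u (e f) in
        ((\<lambda>s. D s j \<psi>) has_integral (X t j \<psi> - X 0 j \<psi> - (\<Sum>k\<in>UNIV. I k \<psi>))) {0..t}))"


section \<open>Arrays\<close>

definition array_section :: "'x ^ 's ^ 'q ^ 'p \<Rightarrow> 's \<Rightarrow> 'x ^ 'q ^ 'p"
  where "array_section T l = (\<chi> j k. T $ j $ k $ l)"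

definition diamond :: "real ^ 'n ^ 'n ^ 'n \<Rightarrow> real ^ 'n \<Rightarrow> real ^ 'n ^ 'n"  (infixl \<open>\<diamondop>\<close> 70)
  where "T \<diamondop> u = (\<chi> i l. (array_section T l *v u) $ i)"

text \<open>Column-stacking: the index \<open>(l, j)\<close> is position \<open>j\<close> in block (column) \<open>l\<close>.\<close>

definition vec_stack :: "real ^ 'n ^ 'm \<Rightarrow> real ^ ('n \<times> 'm)"
  where "vec_stack G = (\<chi> p. G $ snd p $ fst p)"

definition section_row :: "real ^ 's ^ 'q ^ 'p \<Rightarrow> real ^ ('s \<times> 'q) ^ 'p"
  where "section_row T = (\<chi> i p. array_section T (fst p) $ i $ snd p)"

text \<open>Prepending a column (entry) to a matrix (vector); \<open>None\<close> is the index of the new one.\<close>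

definition col_cons :: "real ^ 'm \<Rightarrow> real ^ 'n ^ 'm \<Rightarrow> real ^ ('n option) ^ 'm"
  where "col_cons u G = (\<chi> i k. case k of None \<Rightarrow> u $ i | Some l \<Rightarrow> G $ i $ l)"

definition vec_cons :: "real \<Rightarrow> real ^ 'n \<Rightarrow> real ^ ('n option)"
  where "vec_cons a u = (\<chi> k. case k of None \<Rightarrow> a | Some l \<Rightarrow> u $ l)"

definition outer :: "real ^ 'm \<Rightarrow> real ^ 'n \<Rightarrow> real ^ 'n ^ 'm"
  where "outer u v = (\<chi> i k. u $ i * v $ k)"

end

theory Submission
  imports Defs
begin

text \<open>The state is the finite-rank operator \<open>\<rho>0 \<otimes> |\<Omega>\<rangle>\<langle>\<Omega>|\<close>, so an expectation is a finite linear
  combination of matrix elements between vectors \<open>u \<otimes> \<Omega>\<close> with \<open>\<Omega>\<close> the vacuum. Between such vectors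
  the stochastic integrals vanish, because an operator adapted to the past, applied to
  \<open>v \<otimes> dW \<Omega>\<close>, yields a vector orthogonal to every \<open>u \<otimes> \<Omega>\<close>. Since \<open>X 0 l\<close> maps \<open>v \<otimes> \<Omega>\<close> to a vector of the same form, both
  \<open>E X(t)\<close> and \<open>Re E (X(t) X(0)\<^sup>T)\<close> satisfy linear integral equations with kernel \<open>A\<close>. The formula
  for \<open>\<Delta>\<close> follows by expanding \<open>\<xi> \<xi>\<^sup>T\<close> and reducing \<open>X X\<^sup>T\<close> by the algebraic relations.\<close>

section \<open>Complex Hilbert spaces\<close>

lemma cinner_scaleC_left: "cinner (a *\<^sub>C x) y = cnj a * cinner x y"
  by (metis cinner_scaleC_right cinner_commute complex_cnj_mult)

lemma cinner_scaleR_right: "cinner x (r *\<^sub>R y) = r *\<^sub>R cinner x y"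
  by (metis cinner_scaleC_right scaleC_of_real scaleR_conv_of_real)

lemma cinner_self: "cinner x x = of_real ((norm x)\<^sup>2)"
proof (rule complex_eqI)
  have "Im (cinner x x) = - Im (cinner x x)"
    by (metis cinner_commute cnj.sel(2))
  then show "Im (cinner x x) = Im (of_real ((norm x)\<^sup>2))"
    by simp
qed (simp add: Re_cinner power2_norm_eq_inner)

lemma norm_scaleC: "norm (a *\<^sub>C x) = cmod a * norm x"
proof -
  have "complex_of_real ((norm (a *\<^sub>C x))\<^sup>2) = cnj a * a * cinner x x"
    unfolding cinner_self[symmetric] by (simp add: cinner_scaleC_left cinner_scaleC_right)
  also have "\<dots> = of_real ((cmod a * norm x)\<^sup>2)"
    unfolding cinner_self
    by (metis complex_norm_square mult.commute of_real_mult power_mult_distrib)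
  finally show ?thesis
    by (metis abs_of_nonneg norm_ge_zero of_real_eq_iff power2_eq_iff_nonneg mult_nonneg_nonneg)
qed

text \<open>Multiplying \<open>y\<close> by the conjugate of \<open>cinner x y\<close> makes the
  inner product with \<open>x\<close> real and equal to the squared modulus, so the real
  Cauchy-Schwarz inequality applies; one factor of the modulus is then cancelled.\<close>

lemma cmod_cinner_le: "cmod (cinner x y) \<le> norm x * norm y"
proof (cases "cinner x y = 0")
  case False
  have "cinner x (cnj (cinner x y) *\<^sub>C y) = of_real ((cmod (cinner x y))\<^sup>2)"
    by (simp only: cinner_scaleC_right complex_norm_square mult.commute)
  then have "(cmod (cinner x y))\<^sup>2 = x \<bullet> (cnj (cinner x y) *\<^sub>C y)"
    by (metis Re_cinner Re_complex_of_real)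
  also have "\<dots> \<le> norm x * (cmod (cinner x y) * norm y)"
    by (metis norm_cauchy_schwarz norm_scaleC complex_mod_cnj)
  finally show ?thesis
    using False by (simp add: power2_eq_square)
qed simp

lemma bounded_linear_cinner_right: "bounded_linear (cinner x)"
  by (rule bounded_linear_intro[of _ "norm x"])
    (simp_all add: cinner_add_right cinner_scaleR_right, metis cmod_cinner_le mult.commute)

lemma bounded_linear_scaleC: "bounded_linear (\<lambda>x. a *\<^sub>C x)"
proof (rule bounded_linear_intro[of _ "cmod a"])
  show "a *\<^sub>C r *\<^sub>R x = r *\<^sub>R a *\<^sub>C x" for r and x :: 'a
    by (metis scaleC_scaleC scaleC_of_real mult.commute)
qed (simp_all add: scaleC_add_right norm_scaleC mult.commute)

lemma bounded_linear_scaleC_left: "bounded_linear (\<lambda>a. a *\<^sub>C x)"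
proof (rule bounded_linear_intro[of _ "norm x"])
  show "(r *\<^sub>R a) *\<^sub>C x = r *\<^sub>R a *\<^sub>C x" for r a
    by (metis scaleC_scaleC scaleC_of_real scaleR_conv_of_real)
qed (simp_all add: scaleC_add_left norm_scaleC)

lemmas cinner_simps_right =
  linear_sum[OF bounded_linear.linear[OF bounded_linear_cinner_right]]
  linear_0[OF bounded_linear.linear[OF bounded_linear_cinner_right]]
  linear_diff[OF bounded_linear.linear[OF bounded_linear_cinner_right]]
  cinner_add_right cinner_scaleC_right cinner_scaleR_right

lemma cinner_simps_left:
  "cinner (\<Sum>i\<in>I. f i) y = (\<Sum>i\<in>I. cinner (f i) y)"
  "cinner (x - x') y = cinner x y - cinner x' y"
  "cinner (r *\<^sub>R x) y = r *\<^sub>R cinner x y"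
  unfolding cinner_commute[of _ y] by (simp_all add: cinner_simps_right)

lemmas scaleC_simps =
  linear_sum[OF bounded_linear.linear[OF bounded_linear_scaleC]]
  linear_0[OF bounded_linear.linear[OF bounded_linear_scaleC]]
  linear_diff[OF bounded_linear.linear[OF bounded_linear_scaleC]]
  linear_sum[OF bounded_linear.linear[OF bounded_linear_scaleC_left]]
  linear_0[OF bounded_linear.linear[OF bounded_linear_scaleC_left]]
  linear_diff[OF bounded_linear.linear[OF bounded_linear_scaleC_left]]

lemma scaleC_one [simp]: "1 *\<^sub>C x = x"
  by (metis of_real_1 scaleC_of_real scaleR_one)

lemma subspace_cspan: "subspace (cspan S)"
  unfolding cspan_def by (rule subspace_span)

lemma scaleC_in_cspan: "x \<in> S \<Longrightarrow> c *\<^sub>C x \<in> cspan S"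
  unfolding cspan_def by (rule span_base) blast

lemma cspan_mono: "S \<subseteq> T \<Longrightarrow> cspan S \<subseteq> cspan T"
  unfolding cspan_def by (intro span_mono) auto

section \<open>Bounded complex-linear maps\<close>

lemma bounded_clinear_D:
  assumes "bounded_clinear T"
  shows "bounded_linear T" and "T (c *\<^sub>C x) = c *\<^sub>C T x"
    and "T (x + y) = T x + T y" and "T (x - y) = T x - T y" and "T (r *\<^sub>R x) = r *\<^sub>R T x"
    and "T (sum f I) = (\<Sum>i\<in>I. T (f i))" and "T 0 = 0"
  using assms linear_add[of T] linear_diff[of T] linear_scale[of T] linear_sum[of T] linear_0[of T]
    bounded_linear.linear[of T]
  unfolding bounded_clinear_def by blast+

lemma bounded_clinear_comp:
  "bounded_clinear S \<Longrightarrow> bounded_clinear T \<Longrightarrow> bounded_clinear (\<lambda>x. S (T x))"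
  unfolding bounded_clinear_def by (auto intro: bounded_linear_compose)

lemma bounded_clinear_diff:
  "bounded_clinear S \<Longrightarrow> bounded_clinear T \<Longrightarrow> bounded_clinear (\<lambda>x. S x - T x)"
  unfolding bounded_clinear_def by (auto intro: bounded_linear_sub simp: scaleC_simps)

lemma bounded_clinear_sum:
  "(\<And>i. i \<in> I \<Longrightarrow> bounded_clinear (T i)) \<Longrightarrow> bounded_clinear (\<lambda>x. \<Sum>i\<in>I. T i x)"
  unfolding bounded_clinear_def by (auto intro: bounded_linear_sum simp: scaleC_simps)

lemma bounded_clinear_scaleR:
  "bounded_clinear T \<Longrightarrow> bounded_clinear (\<lambda>x. r *\<^sub>R T x)"
  unfolding bounded_clinear_def
  by (auto intro: bounded_linear_const_scaleR
      simp: linear_scale[OF bounded_linear.linear[OF bounded_linear_scaleC]])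

lemma bounded_clinear_rank_one:
  "bounded_clinear (\<lambda>x. cinner w x *\<^sub>C v)"
  unfolding bounded_clinear_def
  by (auto intro!: bounded_linear_compose[OF bounded_linear_scaleC_left]
      bounded_linear_cinner_right simp: cinner_simps_right scaleC_scaleC)

text \<open>The difference vanishes on the span by linearity and on its closure by continuity. It
  later identifies the state with a finite-rank operator from its values on product vectors.\<close>

lemma bounded_clinear_eq_on_dense:
  assumes S: "bounded_clinear S" and T: "bounded_clinear T"
    and eq: "\<And>x. x \<in> D \<Longrightarrow> S x = T x" and dense: "closure (cspan D) = UNIV"
  shows "S x = T x"
proof -
  have *: "bounded_clinear (\<lambda>x. S x - T x)"
    by (rule bounded_clinear_diff[OF S T])
  have zero: "S y - T y = 0" if "y \<in> cspan D" for y
    using that unfolding cspan_def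
  proof (rule linear_eq_0_on_span[OF bounded_linear.linear[OF bounded_clinear_D(1)[OF *]], rotated])
    show "S y - T y = 0" if "y \<in> {c *\<^sub>C x |c x. x \<in> D}" for y
      using that by (auto simp: bounded_clinear_D(2)[OF S] bounded_clinear_D(2)[OF T] eq)
  qed
  have cont: "continuous_on (closure (cspan D)) (\<lambda>y. S y - T y)"
    by (rule linear_continuous_on[OF bounded_clinear_D(1)[OF *]])
  have "S x - T x = 0"
    by (rule continuous_constant_on_closure[OF cont zero]) (simp_all add: dense)
  then show ?thesis
    by simp
qed

section \<open>Orthonormal bases\<close>

text \<open>The first half of \<open>orthonormal_basis\<close>, split off because it passes to
  subsets and to unions of chains, while density of the span does not.\<close>

definition orthonormal :: "'a::complex_hilbert set \<Rightarrow> bool"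
  where "orthonormal B \<longleftrightarrow> (\<forall>x\<in>B. \<forall>y\<in>B. cinner x y = (if x = y then 1 else 0))"

lemma orthonormalD: "orthonormal B \<Longrightarrow> x \<in> B \<Longrightarrow> y \<in> B \<Longrightarrow> cinner x y = (if x = y then 1 else 0)"
  unfolding orthonormal_def by blast

lemma orthonormal_subset: "orthonormal B \<Longrightarrow> F \<subseteq> B \<Longrightarrow> orthonormal F"
  unfolding orthonormal_def by blast

lemma cinner_eq_0_on_cspan:
  assumes "\<And>x. x \<in> B \<Longrightarrow> cinner w x = 0" and "y \<in> cspan B"
  shows "cinner w y = 0"
  using assms(2) unfolding cspan_def
  by (rule linear_eq_0_on_span[OF bounded_linear.linear[OF bounded_linear_cinner_right], rotated])
    (auto simp: cinner_simps_right assms(1))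

text \<open>\<open>cspan\<close> is a real span of complex multiples, so a member is a finite real
  combination of vectors \<open>c *\<^sub>C x\<close>. Choosing one pair of \<open>c\<close> and
  \<open>x\<close> for each of them leaves finitely many \<open>x\<close>.\<close>

lemma cspan_finite_subset:
  assumes "y \<in> cspan B"
  obtains F where "finite F" "F \<subseteq> B" "y \<in> cspan F"
proof -
  have "\<exists>t r. y = (\<Sum>a\<in>t. r a *\<^sub>R a) \<and> finite t \<and> t \<subseteq> {c *\<^sub>C x |c x. x \<in> B}"
    using assms unfolding cspan_def span_explicit mem_Collect_eq .
  then obtain t r where y: "y = (\<Sum>a\<in>t. r a *\<^sub>R a)" and t: "finite t" "t \<subseteq> {c *\<^sub>C x |c x. x \<in> B}"
    by (elim exE conjE) (rule that)
  have "t \<subseteq> (\<lambda>(c, x). c *\<^sub>C x) ` (UNIV \<times> B)"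
    using t(2) by (force simp: image_iff)
  from finite_subset_image[OF t(1) this]
  obtain C where C: "C \<subseteq> UNIV \<times> B" "finite C" "t = (\<lambda>(c, x). c *\<^sub>C x) ` C"
    by blast
  show thesis
  proof
    show "finite (snd ` C)" and "snd ` C \<subseteq> B"
      using C by auto
    have "a \<in> cspan (snd ` C)" if "a \<in> t" for a
      using that unfolding C(3) by (force intro: scaleC_in_cspan simp: image_iff)
    then show "y \<in> cspan (snd ` C)"
      unfolding y by (intro subspace_sum[OF subspace_cspan] subspace_scale[OF subspace_cspan])
  qed
qed

text \<open>The Fourier sum \<open>p\<close> is the orthogonal projection of \<open>w\<close>:
  \<open>w - p\<close> is orthogonal to \<open>cspan F\<close>, which contains \<open>p - y\<close>,
  and Pythagoras gives the inequality.\<close>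

lemma orthonormal_best_approximation:
  assumes "orthonormal F" and "finite F" and "y \<in> cspan F"
  shows "norm (w - (\<Sum>x\<in>F. cinner x w *\<^sub>C x)) \<le> norm (w - y)"
proof -
  define p where "p = (\<Sum>x\<in>F. cinner x w *\<^sub>C x)"
  have "cinner x (w - p) = 0" if "x \<in> F" for x
    using that assms(1,2)
    by (simp add: p_def cinner_simps_right orthonormalD sum.delta' if_distrib[of "(*) _"] cong: if_cong)
  then have "cinner (w - p) x = 0" if "x \<in> F" for x
    using that by (metis cinner_commute complex_cnj_zero)
  moreover have "p - y \<in> cspan F"
    unfolding p_def using assms(3)
    by (intro subspace_diff[OF subspace_cspan] subspace_sum[OF subspace_cspan] scaleC_in_cspan)
  ultimately have "orthogonal (w - p) (p - y)"
    unfolding orthogonal_def Re_cinner[symmetric]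
    using cinner_eq_0_on_cspan[of F "w - p" "p - y"] by simp
  from norm_add_Pythagorean[OF this] have "(norm (w - y))\<^sup>2 = (norm (w - p))\<^sup>2 + (norm (p - y))\<^sup>2"
    by simp
  then have "(norm (w - p))\<^sup>2 \<le> (norm (w - y))\<^sup>2"
    by simp
  then show ?thesis
    unfolding p_def by (rule power2_le_imp_le) simp
qed

text \<open>By density some \<open>y\<close> in the span of a finite \<open>F\<close> is within
  \<epsilon> of \<open>w\<close>. For every finite \<open>G\<close> between \<open>F\<close> and
  \<open>B\<close> the Fourier sum over \<open>G\<close> is at least as close to \<open>w\<close> as
  \<open>y\<close>, which is convergence along the net of finite subsets.\<close>

lemma orthonormal_basis_expansion:
  assumes "orthonormal_basis B"
  shows "((\<lambda>x. cinner x w *\<^sub>C x) has_sum w) B"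
  unfolding has_sum_def tendsto_iff
proof (intro allI impI)
  fix \<epsilon> :: real assume "\<epsilon> > 0"
  have ortho: "orthonormal B" and "w \<in> closure (cspan B)"
    using assms unfolding orthonormal_basis_def orthonormal_def by auto
  with \<open>\<epsilon> > 0\<close> obtain y where y: "y \<in> cspan B" "dist y w < \<epsilon>"
    unfolding closure_approachable by blast
  obtain F where F: "finite F" "F \<subseteq> B" "y \<in> cspan F"
    by (rule cspan_finite_subset[OF y(1)])
  show "\<forall>\<^sub>F F in finite_subsets_at_top B. dist (\<Sum>x\<in>F. cinner x w *\<^sub>C x) w < \<epsilon>"
    unfolding eventually_finite_subsets_at_top
  proof (intro exI conjI allI impI)
    fix G assume G: "finite G \<and> F \<subseteq> G \<and> G \<subseteq> B"
    then have "norm (w - (\<Sum>x\<in>G. cinner x w *\<^sub>C x)) \<le> norm (w - y)"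
      using ortho F(3) cspan_mono[of F G]
      by (intro orthonormal_best_approximation) (auto intro: orthonormal_subset)
    with y(2) show "dist (\<Sum>x\<in>G. cinner x w *\<^sub>C x) w < \<epsilon>"
      by (simp add: dist_norm norm_minus_commute)
  qed (use F in auto)
qed

text \<open>A sequence in \<open>S\<close> minimizing the distance to \<open>w\<close> is Cauchy,
  and its limit \<open>y\<close> is the projection. As \<open>S\<close> need not be closed,
  \<open>y\<close> is only found in the closure.\<close>

lemma exists_orthogonal_projection:
  fixes w :: "'a::{real_inner, complete_space}"
  assumes S: "subspace S"
  obtains y where "y \<in> closure S" and "\<And>s. s \<in> S \<Longrightarrow> (w - y) \<bullet> s = 0"
proof -
  define d where "d = infdist w S"
  have S0: "S \<noteq> {}" and d0: "0 \<le> d"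
    using subspace_0[OF S] by (auto simp: d_def infdist_nonneg)
  have dle: "d \<le> norm (w - s)" if "s \<in> S" for s
    using infdist_le[OF that, of w] by (simp add: d_def dist_norm)
  have "\<exists>s\<in>S. norm (w - s) < d + 1 / real (Suc n)" for n
  proof -
    have "\<exists>a\<in>S. dist w a < infdist w S + 1 / real (Suc n)"
      using infdist_notempty[OF S0, of w] cInf_lessD[of "dist w ` S" "infdist w S + 1 / real (Suc n)"] S0
      by auto
    then show ?thesis
      by (simp add: d_def dist_norm)
  qed
  then obtain f where f: "\<And>n. f n \<in> S" "\<And>n. norm (w - f n) < d + 1 / real (Suc n)"
    by metis
  have lim: "(\<lambda>n. norm (w - f n)) \<longlonglongrightarrow> d"
  proof (rule tendsto_sandwich[of "\<lambda>_. d" _ _ "\<lambda>n. d + 1 / real (Suc n)"])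
    show "(\<lambda>n. d + 1 / real (Suc n)) \<longlonglongrightarrow> d"
      using tendsto_add[OF tendsto_const LIMSEQ_inverse_real_of_nat, of d]
      by (simp add: inverse_eq_divide)
  qed (use f dle in \<open>auto intro!: always_eventually less_imp_le\<close>)
  \<comment> \<open>The parallelogram identity for \<open>w - f m\<close> and
    \<open>w - f n\<close>: the midpoint of \<open>f m\<close> and \<open>f n\<close> lies in
    \<open>S\<close>, hence at distance at least \<open>d\<close> from \<open>w\<close>.\<close>
  have par: "(norm (f m - f n))\<^sup>2 \<le> 2 * (norm (w - f m))\<^sup>2 + 2 * (norm (w - f n))\<^sup>2 - 4 * d\<^sup>2" for m n
  proof -
    have "(1/2) *\<^sub>R (f m + f n) \<in> S"
      using f(1) S by (intro subspace_scale subspace_add)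
    then have "d\<^sup>2 \<le> (norm (w - (1/2) *\<^sub>R (f m + f n)))\<^sup>2"
      using d0 dle by (intro power_mono)
    then show ?thesis
      unfolding power2_norm_eq_inner
      by (simp add: inner_diff_left inner_diff_right inner_add_left inner_add_right inner_commute
          algebra_simps)
  qed
  have "Cauchy f"
  proof (rule metric_CauchyI)
    fix \<epsilon> :: real assume \<epsilon>: "\<epsilon> > 0"
    have "(\<lambda>n. 2 * (norm (w - f n))\<^sup>2 - 2 * d\<^sup>2) \<longlonglongrightarrow> 2 * d\<^sup>2 - 2 * d\<^sup>2"
      by (intro tendsto_intros lim)
    then have "\<forall>\<^sub>F n in sequentially. 2 * (norm (w - f n))\<^sup>2 - 2 * d\<^sup>2 < \<epsilon>\<^sup>2 / 2"
      using \<epsilon> by (intro order_tendstoD(2)[of _ "2 * d\<^sup>2 - 2 * d\<^sup>2"]) auto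
    then obtain k where k: "\<And>n. n \<ge> k \<Longrightarrow> 2 * (norm (w - f n))\<^sup>2 - 2 * d\<^sup>2 < \<epsilon>\<^sup>2 / 2"
      unfolding eventually_sequentially by blast
    show "\<exists>k. \<forall>m\<ge>k. \<forall>n\<ge>k. dist (f m) (f n) < \<epsilon>"
    proof (intro exI[of _ k] allI impI)
      fix m n assume "m \<ge> k" "n \<ge> k"
      then have "(norm (f m - f n))\<^sup>2 < \<epsilon>\<^sup>2"
        using par[of m n] k[of m] k[of n] by argo
      then show "dist (f m) (f n) < \<epsilon>"
        unfolding dist_norm using \<epsilon> by (intro power2_less_imp_less[of _ \<epsilon>]) auto
    qed
  qed
  then obtain y where y: "f \<longlonglongrightarrow> y"
    using Cauchy_convergent convergent_def by blast
  have yd: "norm (w - y) = d"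
    by (rule LIMSEQ_unique[OF _ lim]) (intro tendsto_intros y)
  show thesis
  proof
    show "y \<in> closure S"
      unfolding closure_sequential using f(1) y by blast
    fix s assume s: "s \<in> S"
    \<comment> \<open>\<open>y\<close> itself may lie outside \<open>S\<close>, so the bound is
      obtained for \<open>f n + a *\<^sub>R s\<close>, which is in \<open>S\<close>, and passed to
      the limit.\<close>
    have le: "d \<le> norm (w - y - a *\<^sub>R s)" for a
    proof (rule tendsto_lowerbound)
      show "(\<lambda>n. norm (w - f n - a *\<^sub>R s)) \<longlonglongrightarrow> norm (w - y - a *\<^sub>R s)"
        by (intro tendsto_intros y)
      have "d \<le> norm (w - (f n + a *\<^sub>R s))" for n
        using f(1) s S by (intro dle subspace_add subspace_scale)
      then show "\<forall>\<^sub>F n in sequentially. d \<le> norm (w - f n - a *\<^sub>R s)"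
        by (simp add: diff_diff_eq)
    qed simp
    show "(w - y) \<bullet> s = 0"
    proof (cases "s = 0")
      case False
      \<comment> \<open>This \<open>a\<close> minimizes the quadratic polynomial that gives the
        squared norm of \<open>w - y - a *\<^sub>R s\<close>.\<close>
      define a where "a = ((w - y) \<bullet> s) / (s \<bullet> s)"
      have "(norm (w - y))\<^sup>2 \<le> (norm (w - y - a *\<^sub>R s))\<^sup>2"
        using le[of a] yd d0 by (simp add: power_mono)
      also have "\<dots> = (norm (w - y))\<^sup>2 - 2 * a * ((w - y) \<bullet> s) + a * a * (s \<bullet> s)"
        unfolding power2_norm_eq_inner
        by (simp add: inner_diff_left inner_diff_right inner_commute algebra_simps)
      also have "\<dots> = (norm (w - y))\<^sup>2 - ((w - y) \<bullet> s)\<^sup>2 / (s \<bullet> s)"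
        using False by (simp add: a_def power2_eq_square)
      finally show ?thesis
        using inner_gt_zero_iff[of s] False by (auto simp: divide_le_0_iff simp del: inner_gt_zero_iff)
    qed simp
  qed
qed

text \<open>Needed because \<open>trace_op\<close> picks its basis by \<open>SOME\<close>. Zorn's
  lemma yields a maximal orthonormal set; were its span not dense, the normalized residual of a
  projection could be added to it.\<close>

lemma exists_orthonormal_basis: "\<exists>B :: 'a::complex_hilbert set. orthonormal_basis B"
proof -
  define \<C> where "\<C> = {B :: 'a set. orthonormal B}"
  have "\<exists>B\<in>\<C>. \<forall>D\<in>\<C>. B \<subseteq> D \<longrightarrow> D = B"
  proof (rule subset_Zorn_nonempty)
    show "\<C> \<noteq> {}"
      unfolding \<C>_def orthonormal_def by blast
    fix C assume "C \<noteq> {}" and C: "subset.chain \<C> C"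
    show "\<Union> C \<in> \<C>"
      unfolding \<C>_def orthonormal_def mem_Collect_eq
    proof (intro ballI)
      fix x y assume "x \<in> \<Union> C" "y \<in> \<Union> C"
      then obtain D where "D \<in> C" "x \<in> D" "y \<in> D"
        using C unfolding subset_chain_def by blast
      then show "cinner x y = (if x = y then 1 else 0)"
        using C unfolding subset_chain_def \<C>_def using orthonormalD[of D x y] by blast
    qed
  qed
  then obtain B :: "'a set" where B: "orthonormal B"
    and max: "\<And>D. orthonormal D \<Longrightarrow> B \<subseteq> D \<Longrightarrow> D = B"
    unfolding \<C>_def by blast
  have "w \<in> closure (cspan B)" for w
  proof (rule ccontr)
    assume w: "w \<notin> closure (cspan B)"
    obtain y where y: "y \<in> closure (cspan B)" and perp: "\<And>s. s \<in> cspan B \<Longrightarrow> (w - y) \<bullet> s = 0"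
      using exists_orthogonal_projection[OF subspace_cspan] by blast
    define v where "v = (1 / norm (w - y)) *\<^sub>R (w - y)"
    have v1: "norm v = 1"
      using w y by (auto simp: v_def)
    have v0: "cinner v x = 0" if "x \<in> B" for x
    proof -
      \<comment> \<open>The projection lemma gives orthogonality for the real inner product only.
        Testing with \<open>x\<close> multiplied by the conjugate of \<open>cinner (w - y) x\<close>
        turns the real part into the squared modulus of the complex inner product.\<close>
      have "Re (cinner (w - y) (cnj (cinner (w - y) x) *\<^sub>C x)) = 0"
        unfolding Re_cinner by (rule perp[OF scaleC_in_cspan[OF that]])
      then have "cinner (w - y) x = 0"
        by (simp add: cinner_scaleC_right sum_power2_eq_zero_iff complex_eq_iff flip: power2_eq_square)
      then show ?thesis
        unfolding v_def
        by (metis cinner_scaleC_left mult_zero_right scaleC_of_real)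
    qed
    have "orthonormal (insert v B)"
      unfolding orthonormal_def
    proof (intro ballI)
      have "cinner x v = 0" if "x \<in> B" for x
        using v0[OF that] by (metis cinner_commute complex_cnj_zero)
      moreover have "cinner v v = 1"
        by (simp add: cinner_self v1)
      ultimately show "cinner x y = (if x = y then 1 else 0)"
        if "x \<in> insert v B" "y \<in> insert v B" for x y
        using that v0 orthonormalD[OF B] by (cases "x = v"; cases "y = v") force+
    qed
    then have "v \<in> B"
      using max by blast
    with v0[of v] v1 show False
      by (simp add: cinner_self)
  qed
  with B show ?thesis
    unfolding orthonormal_basis_def orthonormal_def by blast
qed

text \<open>A complex spanning set \<open>G\<close> together with its multiples by i spans over the
  reals, and an orthonormal set is linearly independent over the reals, so its size is bounded by
  that of the spanning set.\<close>

lemma orthonormal_finite: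
  assumes fin: "finite_cdim TYPE('a::complex_hilbert)" and B: "orthonormal (B :: 'a set)"
  shows "finite B"
proof -
  obtain G :: "'a set" where G: "finite G" "cspan G = UNIV"
    using fin unfolding finite_cdim_def by blast
  define G' where "G' = G \<union> (\<lambda>x. \<i> *\<^sub>C x) ` G"
  have "c *\<^sub>C x \<in> span G'" if "x \<in> G" for c x
  proof -
    have "c *\<^sub>C x = Re c *\<^sub>R x + Im c *\<^sub>R (\<i> *\<^sub>C x)"
      unfolding scaleC_of_real[symmetric] scaleC_scaleC scaleC_add_left[symmetric]
      by (simp add: mult.commute flip: complex_eq)
    moreover have "Re c *\<^sub>R x + Im c *\<^sub>R (\<i> *\<^sub>C x) \<in> span G'"
      using that by (intro span_add span_scale span_base) (auto simp: G'_def)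
    ultimately show ?thesis by simp
  qed
  then have "cspan G \<subseteq> span G'"
    unfolding cspan_def by (intro span_minimal) auto
  then have span: "B \<subseteq> span G'"
    using G(2) by auto
  have "independent B"
    unfolding dependent_explicit
  proof safe
    fix t r v assume t: "finite t" "t \<subseteq> B" "(\<Sum>v\<in>t. r v *\<^sub>R v) = 0" and v: "v \<in> t" and r: "r v \<noteq> 0"
    have "0 = cinner v (\<Sum>v\<in>t. r v *\<^sub>R v)"
      by (simp add: t cinner_simps_right)
    also have "\<dots> = (\<Sum>x\<in>t. if v = x then complex_of_real (r v) else 0)"
      unfolding cinner_simps_right using t v B
      by (intro sum.cong) (auto simp: orthonormalD[OF B] subset_iff scaleR_conv_of_real)
    also have "\<dots> = of_real (r v)"
      using t v by simp
    finally show False using r by simp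
  qed
  then show ?thesis
    using independent_span_bound[of G' B] G(1) span by (auto simp: G'_def)
qed

section \<open>Tensor products and expectations\<close>

text \<open>Each \<open>v i\<close> is expanded in the chosen basis and the bounded functional
  sending \<open>x\<close> to \<open>cinner (w i) (\<zeta> x)\<close> is applied to the expansion.
  The result does not depend on the basis, so the choice in \<open>trace_op\<close>
  disappears.\<close>

lemma trace_op_finite_rank:
  fixes T \<zeta> :: "'h::complex_hilbert \<Rightarrow> 'h"
  assumes fin: "finite I" and T: "\<And>x. T x = (\<Sum>i\<in>I. cinner (w i) (\<zeta> x) *\<^sub>C v i)"
    and \<zeta>: "bounded_clinear \<zeta>"
  shows "trace_op T = (\<Sum>i\<in>I. cinner (w i) (\<zeta> (v i)))"
proof -
  define B :: "'h set" where "B = (SOME B. orthonormal_basis B)"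
  have B: "orthonormal_basis B"
    unfolding B_def by (rule someI_ex[OF exists_orthonormal_basis])
  have "((\<lambda>x. cinner (w i) (\<zeta> x) * cinner x (v i)) has_sum cinner (w i) (\<zeta> (v i))) B" for i
  proof -
    have "bounded_linear (\<lambda>x. cinner (w i) (\<zeta> x))"
      by (rule bounded_linear_compose[OF bounded_linear_cinner_right bounded_clinear_D(1)[OF \<zeta>]])
    from has_sum_bounded_linear[OF this orthonormal_basis_expansion[OF B]]
    show ?thesis
      by (simp add: o_def bounded_clinear_D(2)[OF \<zeta>] cinner_scaleC_right mult.commute)
  qed
  then have "((\<lambda>F. \<Sum>i\<in>I. \<Sum>x\<in>F. cinner (w i) (\<zeta> x) * cinner x (v i)) \<longlongrightarrow>
      (\<Sum>i\<in>I. cinner (w i) (\<zeta> (v i)))) (finite_subsets_at_top B)"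
    unfolding has_sum_def by (intro tendsto_sum)
  moreover have "(\<Sum>i\<in>I. \<Sum>x\<in>F. cinner (w i) (\<zeta> x) * cinner x (v i)) = (\<Sum>x\<in>F. cinner x (T x))" for F
    unfolding T cinner_simps_right by (rule sum.swap)
  ultimately have "((\<lambda>x. cinner x (T x)) has_sum (\<Sum>i\<in>I. cinner (w i) (\<zeta> (v i)))) B"
    unfolding has_sum_def by simp
  then show ?thesis
    unfolding trace_op_def B_def[symmetric] by (rule infsumI)
qed

lemma hilbert_tensor_D:
  assumes "hilbert_tensor ten"
  shows "ten (u + v) x = ten u x + ten v x" and "ten (c *\<^sub>C u) x = c *\<^sub>C ten u x"
    and "ten u (x + y) = ten u x + ten u y" and "ten u (c *\<^sub>C x) = c *\<^sub>C ten u x"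
    and "cinner (ten u x) (ten v y) = cinner u v * cinner x y"
    and "closure (cspan {ten u x | u x. True}) = UNIV"
  using assms unfolding hilbert_tensor_def by blast+

lemma norm_hilbert_tensor:
  assumes "hilbert_tensor ten"
  shows "norm (ten u x) = norm u * norm x"
proof -
  have "complex_of_real ((norm (ten u x))\<^sup>2) = of_real ((norm u * norm x)\<^sup>2)"
    using hilbert_tensor_D(5)[OF assms, of u x u x] by (simp add: cinner_self power_mult_distrib)
  then show ?thesis
    by (simp add: power2_eq_iff_nonneg flip: of_real_power)
qed

lemma bounded_clinear_tensor_right:
  assumes "hilbert_tensor ten"
  shows "bounded_clinear (ten u)"
  unfolding bounded_clinear_def
proof (intro conjI allI bounded_linear_intro[of _ "norm u"])
  show "ten u (r *\<^sub>R x) = r *\<^sub>R ten u x" for r x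
    by (metis hilbert_tensor_D(4)[OF assms] scaleC_of_real)
qed (simp_all add: hilbert_tensor_D[OF assms] norm_hilbert_tensor[OF assms] mult.commute)

lemma bounded_clinear_tensor_left:
  assumes "hilbert_tensor ten"
  shows "bounded_clinear (\<lambda>u. ten u x)"
  unfolding bounded_clinear_def
proof (intro conjI allI bounded_linear_intro[of _ "norm x"])
  show "ten (r *\<^sub>R u) x = r *\<^sub>R ten u x" for r u
    by (metis hilbert_tensor_D(2)[OF assms] scaleC_of_real)
qed (simp_all add: hilbert_tensor_D[OF assms] norm_hilbert_tensor[OF assms])

lemma orthonormal_basis_sum:
  assumes "orthonormal_basis B" and "finite B"
  shows "(\<Sum>x\<in>B. cinner x w *\<^sub>C x) = w"
  using orthonormal_basis_expansion[OF assms(1), of w] assms(2)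
  by (simp add: has_sum_finite_iff)

text \<open>For \<open>r u v = cinner v (\<rho>0 u)\<close> this is the expectation in the product
  of \<rho>0 and the vacuum. As a finite sum of matrix elements it is linear in \<zeta> for
  arbitrary maps \<zeta>, without boundedness assumptions.\<close>

definition matrix_expectation ::
    "('a::complex_hilbert \<Rightarrow> 'f::complex_hilbert \<Rightarrow> 'h::complex_hilbert) \<Rightarrow> 'f \<Rightarrow>
     'a set \<Rightarrow> ('a \<Rightarrow> 'a \<Rightarrow> complex) \<Rightarrow> ('h \<Rightarrow> 'h) \<Rightarrow> complex"
  where "matrix_expectation ten \<Omega> B r \<zeta> =
    (\<Sum>u\<in>B. \<Sum>v\<in>B. r u v * cinner (ten u \<Omega>) (\<zeta> (ten v \<Omega>)))"

text \<open>On product vectors \<rho> agrees with a finite sum of rank-one operators, one for each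
  basis vector of the initial space; by density it equals this sum everywhere, and the finite-rank
  trace formula applies.\<close>

lemma expectation_as_matrix_expectation:
  fixes ten :: "'a::complex_hilbert \<Rightarrow> 'f::complex_hilbert \<Rightarrow> 'h::complex_hilbert"
  assumes fin: "finite_cdim TYPE('a)" and ten: "hilbert_tensor ten"
    and rho0: "density_operator \<rho>0"
    and rho: "is_tensor_op ten \<rho>0 (\<lambda>x. cinner \<Omega> x *\<^sub>C \<Omega>) \<rho>" and \<Omega>: "cinner \<Omega> \<Omega> = 1"
  obtains B r where "finite B" and "\<And>u v. r v u = cnj (r u v)"
    and "\<And>\<zeta>. bounded_clinear \<zeta> \<Longrightarrow> expectation \<rho> \<zeta> = matrix_expectation ten \<Omega> B r \<zeta>"
    and "matrix_expectation ten \<Omega> B r (\<lambda>\<psi>. \<psi>) = 1"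
proof -
  \<comment> \<open>The same choice as inside \<open>trace_op\<close>, so that
    \<open>trace_op \<rho>0 = 1\<close> says that the diagonal entries of \<open>r\<close> sum to
    1.\<close>
  define B :: "'a set" where "B = (SOME B. orthonormal_basis B)"
  have B: "orthonormal_basis B"
    unfolding B_def by (rule someI_ex[OF exists_orthonormal_basis])
  then have ortho: "orthonormal B"
    unfolding orthonormal_basis_def orthonormal_def by blast
  have finB: "finite B"
    by (rule orthonormal_finite[OF fin ortho])
  note expand = orthonormal_basis_sum[OF B finB]
  have rho0_sa: "bounded_clinear \<rho>0" "\<And>x y. cinner (\<rho>0 x) y = cinner x (\<rho>0 y)" "trace_op \<rho>0 = 1"
    using rho0 unfolding density_operator_def selfadjoint_def by auto
  have rho_bc: "bounded_clinear \<rho>" and rho_ten: "\<And>u x. \<rho> (ten u x) = ten (\<rho>0 u) (cinner \<Omega> x *\<^sub>C \<Omega>)"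
    using rho unfolding is_tensor_op_def by auto
  note left = bounded_clinear_D[OF bounded_clinear_tensor_left[OF ten]]
  have rho_eq: "\<rho> \<psi> = (\<Sum>u\<in>B. cinner (ten u \<Omega>) \<psi> *\<^sub>C ten (\<rho>0 u) \<Omega>)" for \<psi>
  proof (rule bounded_clinear_eq_on_dense[OF rho_bc _ _ hilbert_tensor_D(6)[OF ten]])
    show "bounded_clinear (\<lambda>\<psi>. \<Sum>u\<in>B. cinner (ten u \<Omega>) \<psi> *\<^sub>C ten (\<rho>0 u) \<Omega>)"
      by (intro bounded_clinear_sum bounded_clinear_rank_one)
    fix \<phi> assume "\<phi> \<in> {ten u x | u x. True}"
    then obtain v x where \<phi>: "\<phi> = ten v x" by blast
    have "ten (\<rho>0 v) \<Omega> = ten (\<rho>0 (\<Sum>u\<in>B. cinner u v *\<^sub>C u)) \<Omega>"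
      by (simp add: expand)
    also have "\<dots> = (\<Sum>u\<in>B. cinner u v *\<^sub>C ten (\<rho>0 u) \<Omega>)"
      by (simp add: bounded_clinear_D[OF rho0_sa(1)] left)
    finally show "\<rho> \<phi> = (\<Sum>u\<in>B. cinner (ten u \<Omega>) \<phi> *\<^sub>C ten (\<rho>0 u) \<Omega>)"
      by (simp add: \<phi> rho_ten hilbert_tensor_D(4,5)[OF ten] scaleC_simps scaleC_scaleC mult.commute)
  qed
  define r where "r = (\<lambda>u v. cinner v (\<rho>0 u))"
  have rho0_ten: "ten (\<rho>0 u) \<Omega> = (\<Sum>v\<in>B. r u v *\<^sub>C ten v \<Omega>)" for u
  proof -
    have "ten (\<rho>0 u) \<Omega> = ten (\<Sum>v\<in>B. cinner v (\<rho>0 u) *\<^sub>C v) \<Omega>"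
      by (simp add: expand)
    then show ?thesis
      by (simp add: left r_def)
  qed
  show thesis
  proof (rule that[OF finB])
    show "r v u = cnj (r u v)" for u v
      unfolding r_def by (metis rho0_sa(2) cinner_commute)
    show "expectation \<rho> \<zeta> = matrix_expectation ten \<Omega> B r \<zeta>" if "bounded_clinear \<zeta>" for \<zeta>
      unfolding expectation_def matrix_expectation_def
      by (subst trace_op_finite_rank[where w = "\<lambda>u. ten u \<Omega>" and v = "\<lambda>u. ten (\<rho>0 u) \<Omega>", OF finB _ that])
        (simp_all add: rho_eq rho0_ten bounded_clinear_D[OF that] cinner_simps_right)
    have "matrix_expectation ten \<Omega> B r (\<lambda>\<psi>. \<psi>) = (\<Sum>u\<in>B. \<Sum>v\<in>B. if u = v then r u v else 0)"
      unfolding matrix_expectation_def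
      by (intro sum.cong) (simp_all add: hilbert_tensor_D(5)[OF ten] \<Omega> orthonormalD[OF ortho])
    also have "\<dots> = (\<Sum>u\<in>B. r u u)"
      using finB by simp
    also have "\<dots> = trace_op \<rho>0"
      unfolding trace_op_def B_def[symmetric] using finB by (simp add: r_def)
    finally show "matrix_expectation ten \<Omega> B r (\<lambda>\<psi>. \<psi>) = 1"
      by (simp add: rho0_sa)
  qed
qed

lemma matrix_expectation_simps:
  "matrix_expectation ten \<Omega> B r (\<lambda>\<psi>. S \<psi> + T \<psi>) =
     matrix_expectation ten \<Omega> B r S + matrix_expectation ten \<Omega> B r T"
  "matrix_expectation ten \<Omega> B r (\<lambda>\<psi>. S \<psi> - T \<psi>) =
     matrix_expectation ten \<Omega> B r S - matrix_expectation ten \<Omega> B r T"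
  "matrix_expectation ten \<Omega> B r (\<lambda>\<psi>. a *\<^sub>R T \<psi>) = a *\<^sub>R matrix_expectation ten \<Omega> B r T"
  "matrix_expectation ten \<Omega> B r (\<lambda>\<psi>. c *\<^sub>C T \<psi>) = c * matrix_expectation ten \<Omega> B r T"
  unfolding matrix_expectation_def
  by (simp_all add: cinner_simps_right distrib_left right_diff_distrib sum.distrib sum_subtractf
      sum_distrib_left scaleR_sum_right mult.left_commute)

lemma matrix_expectation_sum:
  "matrix_expectation ten \<Omega> B r (\<lambda>\<psi>. \<Sum>i\<in>I. T i \<psi>) = (\<Sum>i\<in>I. matrix_expectation ten \<Omega> B r (T i))"
proof -
  have "matrix_expectation ten \<Omega> B r (\<lambda>\<psi>. \<Sum>i\<in>I. T i \<psi>) =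
      (\<Sum>u\<in>B. \<Sum>v\<in>B. \<Sum>i\<in>I. r u v * cinner (ten u \<Omega>) (T i (ten v \<Omega>)))"
    unfolding matrix_expectation_def by (simp add: cinner_simps_right sum_distrib_left)
  also have "\<dots> = (\<Sum>u\<in>B. \<Sum>i\<in>I. \<Sum>v\<in>B. r u v * cinner (ten u \<Omega>) (T i (ten v \<Omega>)))"
    by (intro sum.cong refl sum.swap)
  also have "\<dots> = (\<Sum>i\<in>I. matrix_expectation ten \<Omega> B r (T i))"
    unfolding matrix_expectation_def by (rule sum.swap)
  finally show ?thesis .
qed

text \<open>Conjugating a term replaces \<open>r u v\<close> by \<open>r v u\<close> and moves the
  operator to the other side; exchanging the two summation indices restores the original form. With
  \<open>S = T\<close> it shows that self-adjoint operators have real expectations.\<close>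

lemma matrix_expectation_adjoint:
  assumes "\<And>u v. r v u = cnj (r u v)" and "\<And>\<phi> \<psi>. cinner (S \<phi>) \<psi> = cinner \<phi> (T \<psi>)"
  shows "matrix_expectation ten \<Omega> B r S = cnj (matrix_expectation ten \<Omega> B r T)"
proof -
  have "cnj (matrix_expectation ten \<Omega> B r T) =
      (\<Sum>u\<in>B. \<Sum>v\<in>B. r v u * cinner (ten v \<Omega>) (S (ten u \<Omega>)))"
    unfolding matrix_expectation_def
    by (simp add: assms(1)[symmetric] cinner_commute[symmetric] assms(2)[symmetric])
  also have "\<dots> = matrix_expectation ten \<Omega> B r S"
    unfolding matrix_expectation_def by (rule sum.swap)
  finally show ?thesis by simp
qed

section \<open>Vacuum matrix elements of quantum stochastic integrals\<close>

text \<open>Supplies the test functions in use: zero, whose exponential vector is the vacuum, and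
  multiples of channel indicators together with their parts after a given time.\<close>

lemma simple_in_L2:
  assumes "S \<in> sets borel" and "bounded S"
  shows "(\<lambda>s. if s \<in> S then x else 0) \<in> L2"
  unfolding L2_def mem_Collect_eq
proof
  have S': "S \<inter> {0..} \<in> sets lebesgue"
    using assms(1) by (intro sets_completionI_sets) simp
  then have S: "S \<inter> {0..} \<in> sets (lebesgue_on {0..})"
    by (subst sets_restrict_space_iff) auto
  have pred: "{s \<in> space (lebesgue_on {0..}). s \<in> S} \<in> sets (lebesgue_on {0..})"
    using S by (simp add: space_restrict_space Int_def conj_commute)
  show "(\<lambda>s. if s \<in> S then x else 0) \<in> borel_measurable (lebesgue_on {0..})"
    by (rule measurable_If[OF _ _ pred]) auto
  have "emeasure (lebesgue_on {0..}) (S \<inter> {0..}) = emeasure lebesgue (S \<inter> {0..})"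
    by (rule emeasure_restrict_space) auto
  also have "\<dots> \<noteq> top"
    by (rule fmeasurableD2)
      (intro bounded_set_imp_lmeasurable S' bounded_subset[OF assms(2)], simp)
  finally have "integrable (lebesgue_on {0..}) (indicator (S \<inter> {0..}) :: real \<Rightarrow> real)"
    using S by (intro integrable_real_indicator) (auto simp: less_top)
  then have "integrable (lebesgue_on {0..}) (\<lambda>s. (norm x)\<^sup>2 * indicator (S \<inter> {0..}) s)"
    by (rule integrable_mult_right)
  then show "integrable (lebesgue_on {0..}) (\<lambda>s. (norm (if s \<in> S then x else 0))\<^sup>2)"
    by (rule Bochner_Integration.integrable_cong[THEN iffD1, OF refl, rotated])
      (auto simp: space_restrict_space indicator_def)
qed

lemma zero_in_L2: "(\<lambda>_. 0) \<in> L2"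
  using simple_in_L2[of "{}" 0] by simp

lemma L2_inner_zero [simp]: "L2_inner (\<lambda>_. 0) f = 0" "L2_inner f (\<lambda>_. 0) = 0"
  unfolding L2_inner_def by simp_all

lemma fock_cinner:
  assumes "symmetric_fock_space e" "f \<in> L2"
  shows "cinner (e (\<lambda>_. 0)) (e f) = 1"
  proof -
  have "cinner (e (\<lambda>_. 0)) (e f) = exp (L2_inner (\<lambda>_. 0) f)"
    using assms zero_in_L2 unfolding symmetric_fock_space_def by blast
  then show ?thesis
    by simp
qed

text \<open>The part after time \<open>\<tau>\<close> of \<open>e (\<epsilon> \<chi>)\<close>, \<open>\<chi>\<close> the indicator of \<open>[0, t]\<close>, is invisible here
  because it only contributes a factor \<open>\<langle>e 0, e g\<rangle> = 1\<close>.\<close>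

lemma adapted_op_exponential:
  fixes e :: "(real \<Rightarrow> complex ^ 'c::finite) \<Rightarrow> 'f::complex_hilbert"
  assumes fock: "symmetric_fock_space e" and T: "adapted_op ten e \<tau> T" and \<tau>: "0 \<le> \<tau>" "\<tau> \<le> t"
  shows "cinner (ten u (e (\<lambda>_. 0))) (T (ten v (e (\<lambda>s. \<epsilon> *\<^sub>R channel_indicator j t s)))) =
    cinner (ten u (e (\<lambda>_. 0))) (T (ten v (e (\<lambda>s. \<epsilon> *\<^sub>R channel_indicator j \<tau> s))))"
proof -
  define f where "f = (\<lambda>s. \<epsilon> *\<^sub>R channel_indicator j t s)"
  have f: "f = (\<lambda>s. if s \<in> {0..t} then \<epsilon> *\<^sub>R axis j 1 else 0)"
    unfolding f_def channel_indicator_def by auto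
  have future: "future \<tau> f = (\<lambda>s. if s \<in> {\<tau><..t} then \<epsilon> *\<^sub>R axis j 1 else 0)"
    unfolding f future_def using \<tau> by (intro ext) auto
  have past: "past \<tau> f = (\<lambda>s. \<epsilon> *\<^sub>R channel_indicator j \<tau> s)"
    unfolding f past_def channel_indicator_def using \<tau> by (intro ext) auto
  have "f \<in> L2" "future \<tau> f \<in> L2"
    unfolding future unfolding f by (intro simple_in_L2; simp)+
  moreover have "past \<tau> (\<lambda>_. 0) = (\<lambda>_. 0 :: complex ^ 'c)" "future \<tau> (\<lambda>_. 0) = (\<lambda>_. 0 :: complex ^ 'c)"
    unfolding past_def future_def by auto
  moreover have "cinner (ten u (e (\<lambda>_. 0))) (T (ten v (e f))) =
      cinner (ten u (e (past \<tau> (\<lambda>_. 0)))) (T (ten v (e (past \<tau> f)))) *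
      cinner (e (future \<tau> (\<lambda>_. 0))) (e (future \<tau> f))"
    using T zero_in_L2 \<open>f \<in> L2\<close> unfolding adapted_op_def by blast
  ultimately show ?thesis
    using fock_cinner[OF fock \<open>future \<tau> f \<in> L2\<close>] unfolding f_def[symmetric] past[symmetric] by simp
qed

text \<open>Annihilation kills the vacuum, so both quadratures reduce there to a constant times the
  creation part \<open>cr t\<close>, the derivative at \<epsilon> = 0 of a curve of exponential
  vectors.\<close>

lemma wiener_vacuum:
  assumes "quantum_wiener_process e W"
  obtains \<kappa> cr where "\<And>t. 0 \<le> t \<Longrightarrow> the (W k t (e (\<lambda>_. 0))) = \<kappa> *\<^sub>C cr t"
    and "\<And>t. 0 \<le> t \<Longrightarrow>
      ((\<lambda>\<epsilon>. e (\<lambda>s. \<epsilon> *\<^sub>R channel_indicator (fst k) t s)) has_vector_derivative cr t) (at 0)"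
proof -
  note wiener = conjunct2[OF assms[unfolded quantum_wiener_process_def Let_def]]
  have "\<forall>t\<ge>0. \<exists>cr.
       ((\<lambda>\<epsilon>. e (\<lambda>s. \<epsilon> *\<^sub>R channel_indicator (fst k) t s)) has_vector_derivative cr) (at 0) \<and>
         W (fst k, 1) t (e (\<lambda>_. 0)) = Some cr \<and> W (fst k, 2) t (e (\<lambda>_. 0)) = Some (\<i> *\<^sub>C cr)"
  proof (intro allI impI)
    fix t :: real assume t: "0 \<le> t"
    from wiener[rule_format, OF t zero_in_L2, of "fst k"]
    obtain cr where "((\<lambda>\<epsilon>. e (\<lambda>s. 0 + \<epsilon> *\<^sub>R channel_indicator (fst k) t s))
        has_vector_derivative cr) (at 0)"
      and "W (fst k, 1) t (e (\<lambda>_. 0)) =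
        Some (L2_inner (channel_indicator (fst k) t) (\<lambda>_. 0) *\<^sub>C e (\<lambda>_. 0) + cr)"
      and "W (fst k, 2) t (e (\<lambda>_. 0)) =
        Some ((- \<i>) *\<^sub>C (L2_inner (channel_indicator (fst k) t) (\<lambda>_. 0) *\<^sub>C e (\<lambda>_. 0) - cr))"
      by (elim exE conjE) (rule that)
    moreover have "(- \<i>) *\<^sub>C (0 - cr) = \<i> *\<^sub>C cr"
      using scaleC_simps(3)[of "- \<i>" 0 cr] scaleC_simps(6)[of 0 "- \<i>" cr] by (simp add: scaleC_simps)
    ultimately show "\<exists>cr.
       ((\<lambda>\<epsilon>. e (\<lambda>s. \<epsilon> *\<^sub>R channel_indicator (fst k) t s)) has_vector_derivative cr) (at 0) \<and>
         W (fst k, 1) t (e (\<lambda>_. 0)) = Some cr \<and> W (fst k, 2) t (e (\<lambda>_. 0)) = Some (\<i> *\<^sub>C cr)"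
      by (auto simp: scaleC_simps)
  qed
  then obtain cr where cr: "\<forall>t\<ge>0.
       ((\<lambda>\<epsilon>. e (\<lambda>s. \<epsilon> *\<^sub>R channel_indicator (fst k) t s)) has_vector_derivative cr t) (at 0) \<and>
         W (fst k, 1) t (e (\<lambda>_. 0)) = Some (cr t) \<and> W (fst k, 2) t (e (\<lambda>_. 0)) = Some (\<i> *\<^sub>C cr t)"
    by metis
  show thesis
  \<comment> \<open>The second quadrature is -i times (annihilation minus creation), which leaves
    the factor i.\<close>
  proof (rule that[of "if snd k = 1 then 1 else \<i>" cr])
    show "the (W k t (e (\<lambda>_. 0))) = (if snd k = 1 then 1 else \<i>) *\<^sub>C cr t" if "0 \<le> t" for t
      using cr that exhaust_2[of "snd k"] by (cases k) auto
  qed (use cr in blast)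
qed

text \<open>By \<open>adapted_op_exponential\<close> the curves of exponential vectors for
  \<open>t\<close> and for \<tau> have the same image under the functional \<phi>. Their derivatives
  at \<epsilon> = 0 therefore agree, and these are the values of \<phi> at the two creation
  parts.\<close>

lemma adapted_op_wiener_increment:
  assumes ten: "hilbert_tensor ten" and fock: "symmetric_fock_space e"
    and wiener: "quantum_wiener_process e W" and T: "adapted_op ten e \<tau> T" and \<tau>: "0 \<le> \<tau>" "\<tau> \<le> t"
  shows "cinner (ten u (e (\<lambda>_. 0)))
    (T (ten v (the (W k t (e (\<lambda>_. 0))) - the (W k \<tau> (e (\<lambda>_. 0)))))) = 0"
proof -
  obtain \<kappa> cr where W: "\<And>t. 0 \<le> t \<Longrightarrow> the (W k t (e (\<lambda>_. 0))) = \<kappa> *\<^sub>C cr t"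
    and cr: "\<And>t. 0 \<le> t \<Longrightarrow>
      ((\<lambda>\<epsilon>. e (\<lambda>s. \<epsilon> *\<^sub>R channel_indicator (fst k) t s)) has_vector_derivative cr t) (at 0)"
    by (rule wiener_vacuum[OF wiener, of k]) (rule that)
  define \<phi> where "\<phi> = (\<lambda>x. cinner (ten u (e (\<lambda>_. 0))) (T (ten v x)))"
  have Tb: "bounded_clinear T"
    using T unfolding adapted_op_def by blast
  have "bounded_clinear (\<lambda>x. T (ten v x))"
    by (rule bounded_clinear_comp[OF Tb bounded_clinear_tensor_right[OF ten]])
  then have \<phi>: "bounded_linear \<phi>" "\<And>c x. \<phi> (c *\<^sub>C x) = c * \<phi> x"
    unfolding \<phi>_def
    by (auto intro: bounded_linear_compose[OF bounded_linear_cinner_right] bounded_clinear_D(1)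
        simp: bounded_clinear_D(2)[of "\<lambda>x. T (ten v x)"] cinner_scaleC_right)
  have "((\<lambda>\<epsilon>. \<phi> (e (\<lambda>s. \<epsilon> *\<^sub>R channel_indicator (fst k) t s))) has_vector_derivative \<phi> (cr t)) (at 0)"
    using bounded_linear.has_vector_derivative[OF \<phi>(1) cr] \<tau> by auto
  moreover have "((\<lambda>\<epsilon>. \<phi> (e (\<lambda>s. \<epsilon> *\<^sub>R channel_indicator (fst k) t s))) has_vector_derivative \<phi> (cr \<tau>)) (at 0)"
    using bounded_linear.has_vector_derivative[OF \<phi>(1) cr] \<tau>
    unfolding \<phi>_def adapted_op_exponential[OF fock T \<tau>] by auto
  ultimately have "\<phi> (cr t) = \<phi> (cr \<tau>)"
    by (rule vector_derivative_unique_at)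
  then have "\<phi> (the (W k t (e (\<lambda>_. 0))) - the (W k \<tau> (e (\<lambda>_. 0)))) = 0"
    using \<tau> by (simp add: W \<phi> linear_diff[OF bounded_linear.linear[OF \<phi>(1)]])
  then show ?thesis
    unfolding \<phi>_def .
qed

text \<open>Every summand of a step integral is an adapted operator applied to a later Wiener
  increment, so its vacuum matrix element is zero; the strong limit preserves this.\<close>

lemma vacuum_element_qs_integral:
  assumes ten: "hilbert_tensor ten" and fock: "symmetric_fock_space e"
    and wiener: "quantum_wiener_process e W" and t: "0 \<le> t"
    and I: "has_qs_integral ten e (W k) G t I"
  shows "cinner (ten u (e (\<lambda>_. 0))) (I (ten v (e (\<lambda>_. 0)))) = 0"
proof -
  obtain S where S: "\<And>n. step_adapted ten e (S n)"
    and lim: "(\<lambda>n. step_integral ten (W k) t (S n) v (e (\<lambda>_. 0))) \<longlonglongrightarrow> I (ten v (e (\<lambda>_. 0)))"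
    using I zero_in_L2 unfolding has_qs_integral_def Let_def by blast
  have zero: "cinner (ten u (e (\<lambda>_. 0))) (step_integral ten (W k) t (S n) v (e (\<lambda>_. 0))) = 0" for n
  proof -
    obtain N \<tau> E where SE: "S n = (N, \<tau>, E)"
      by (rule prod_cases3)
    have \<tau>0: "0 \<le> \<tau> 0" and \<tau>: "\<And>i. i < N \<Longrightarrow> \<tau> i < \<tau> (Suc i)" "\<And>i. i < N \<Longrightarrow> adapted_op ten e (\<tau> i) (E i)"
      using S[of n] unfolding SE by auto
    have pos: "i \<le> N \<Longrightarrow> 0 \<le> \<tau> i" for i
    proof (induction i)
      case (Suc i)
      then show ?case using \<tau>(1)[of i] by simp
    qed (use \<tau>0 in simp)
    have "cinner (ten u (e (\<lambda>_. 0))) (E i (ten v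
        (the (W k (min t (\<tau> (Suc i))) (e (\<lambda>_. 0))) - the (W k (min t (\<tau> i)) (e (\<lambda>_. 0)))))) = 0"
      if i: "i < N" for i
    \<comment> \<open>If the step starts after \<open>t\<close>, both truncated times equal
      \<open>t\<close> and the increment is zero; otherwise it starts at \<tau> \<open>i\<close>,
      the time to which \<open>E i\<close> is adapted.\<close>
    proof (cases "\<tau> i \<le> t")
      case True
      then show ?thesis
        using adapted_op_wiener_increment[OF ten fock wiener \<tau>(2)[OF i], of "min t (\<tau> (Suc i))"]
          pos[of i] i \<tau>(1)[OF i] by (simp add: min_absorb2)
    next
      case False
      then have "min t (\<tau> (Suc i)) = min t (\<tau> i)"
        using \<tau>(1)[OF i] by simp
      moreover have "bounded_clinear (E i)"
        using \<tau>(2)[OF i] unfolding adapted_op_def by blast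
      ultimately show ?thesis
        by (simp add: bounded_clinear_D(7) bounded_clinear_tensor_right[OF ten] cinner_simps_right)
    qed
    then show ?thesis
      by (simp add: SE cinner_simps_right)
  qed
  have "(\<lambda>n. cinner (ten u (e (\<lambda>_. 0))) (step_integral ten (W k) t (S n) v (e (\<lambda>_. 0))))
      \<longlonglongrightarrow> cinner (ten u (e (\<lambda>_. 0))) (I (ten v (e (\<lambda>_. 0))))"
    by (rule bounded_linear.tendsto[OF bounded_linear_cinner_right lim])
  then show ?thesis
    unfolding zero by (simp add: LIMSEQ_const_iff)
qed

text \<open>The noise terms drop out and the drift remains. The factor \<open>Z\<close> preserves
  vectors with vacuum second component, so one statement serves for the mean (\<open>Z\<close> the
  identity) and for the correlations with an initial variable (\<open>Z = X 0 k\<close>).\<close>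

lemma qsde_vacuum_expectation:
  assumes ten: "hilbert_tensor ten" and fock: "symmetric_fock_space e"
    and wiener: "quantum_wiener_process e W" and X: "qsde ten e W D G X" and t: "0 \<le> t"
    and Z: "\<And>v. Z (ten v (e (\<lambda>_. 0))) = ten (Z0 v) (e (\<lambda>_. 0))" and B: "finite B"
  shows "((\<lambda>s. matrix_expectation ten (e (\<lambda>_. 0)) B r (\<lambda>\<psi>. D s j (Z \<psi>))) has_integral
    matrix_expectation ten (e (\<lambda>_. 0)) B r (\<lambda>\<psi>. X t j (Z \<psi>)) -
    matrix_expectation ten (e (\<lambda>_. 0)) B r (\<lambda>\<psi>. X 0 j (Z \<psi>))) {0..t}"
proof -
  define w where "w = (\<lambda>u. ten u (e (\<lambda>_. 0)))"
  have "\<exists>I. (\<forall>k. has_qs_integral ten e (W k) (\<lambda>s. G s j k) t (I k)) \<and>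
      (\<forall>u. \<forall>f\<in>L2. let \<psi> = ten u (e f) in
        ((\<lambda>s. D s j \<psi>) has_integral (X t j \<psi> - X 0 j \<psi> - (\<Sum>k\<in>UNIV. I k \<psi>))) {0..t})"
    using X t unfolding qsde_def by blast
  then obtain I where I: "\<And>k. has_qs_integral ten e (W k) (\<lambda>s. G s j k) t (I k)"
    and int: "\<And>v f. f \<in> L2 \<Longrightarrow> ((\<lambda>s. D s j (ten v (e f))) has_integral
        (X t j (ten v (e f)) - X 0 j (ten v (e f)) - (\<Sum>k\<in>UNIV. I k (ten v (e f))))) {0..t}"
    unfolding Let_def by (elim exE conjE) (rule that, blast+)
  have "((\<lambda>s. cinner (w u) (D s j (w v))) has_integral
      cinner (w u) (X t j (w v)) - cinner (w u) (X 0 j (w v))) {0..t}" for u v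
    using has_integral_linear[OF int[OF zero_in_L2] bounded_linear_cinner_right[of "w u"], of v]
      vacuum_element_qs_integral[OF ten fock wiener t I]
    unfolding w_def by (simp add: cinner_simps_right o_def)
  then have "((\<lambda>s. \<Sum>u\<in>B. \<Sum>v\<in>B. r u v * cinner (w u) (D s j (w (Z0 v)))) has_integral
      (\<Sum>u\<in>B. \<Sum>v\<in>B. r u v * (cinner (w u) (X t j (w (Z0 v))) - cinner (w u) (X 0 j (w (Z0 v)))))) {0..t}"
    using B by (intro has_integral_sum has_integral_mult_right)
  then show ?thesis
    unfolding matrix_expectation_def w_def Z by (simp add: right_diff_distrib sum_subtractf)
qed

section \<open>Linear differential equations\<close>

lemma has_vector_derivative_vecI:
  fixes f :: "real \<Rightarrow> 'b::real_normed_vector ^ 'n::finite"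
  assumes "\<And>i. ((\<lambda>t. f t $ i) has_vector_derivative f' $ i) (at x within S)"
  shows "(f has_vector_derivative f') (at x within S)"
  unfolding has_vector_derivative_def has_derivative_def
proof (intro conjI vec_tendstoI)
  show "bounded_linear (\<lambda>h. h *\<^sub>R f')"
    by (rule bounded_linear_scaleR_left)
next
  fix i
  show "((\<lambda>y. ((f y - f (netlimit (at x within S)) - (y - netlimit (at x within S)) *\<^sub>R f') /\<^sub>R
      norm (y - netlimit (at x within S))) $ i) \<longlongrightarrow> 0 $ i) (at x within S)"
    using assms[of i] unfolding has_vector_derivative_def has_derivative_def by simp
qed

text \<open>A bootstrap, as no regularity of \<open>y\<close> is assumed: the integrand is
  integrable, so \<open>y\<close> is continuous as an indefinite integral, so the integrand is
  continuous, and the fundamental theorem of calculus differentiates \<open>y\<close>.\<close>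

lemma integral_equation_imp_ode:
  fixes y :: "real \<Rightarrow> real ^ 'n::finite" and A :: "real \<Rightarrow> real ^ 'n ^ 'n"
  assumes int: "\<And>t j. 0 \<le> t \<Longrightarrow>
      ((\<lambda>s. (\<Sum>k\<in>UNIV. A s $ j $ k * y s $ k) + a $ j) has_integral (y t $ j - y 0 $ j)) {0..t}"
    and A: "continuous_on {0..} A" and t: "0 \<le> t"
  shows "(y has_vector_derivative (A t *v y t + a)) (at t within {0..})"
proof (rule has_vector_derivative_vecI)
  fix j
  \<comment> \<open>With an end point beyond \<open>t\<close>, the intervals from 0 to
    \<open>T\<close> and from 0 to infinity coincide near \<open>t\<close>, also when
    \<open>t = 0\<close>.\<close>
  define T where "T = t + 1"
  define g where "g = (\<lambda>j s. (\<Sum>k\<in>UNIV. A s $ j $ k * y s $ k) + a $ j)"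
  have y: "y s $ j = y 0 $ j + integral {0..s} (g j)" if "0 \<le> s" for s j
    using integral_unique[OF int[OF that, of j]] unfolding g_def by simp
  have "g j integrable_on {0..T}" for j
    unfolding g_def by (rule has_integral_integrable[OF int]) (simp add: T_def t)
  then have "continuous_on {0..T} (\<lambda>s. y 0 $ j + integral {0..s} (g j))" for j
    by (intro continuous_on_add continuous_on_const indefinite_integral_continuous_1)
  then have cont_y: "continuous_on {0..T} (\<lambda>s. y s $ j)" for j
    by (rule continuous_on_eq) (rule y[symmetric], simp)
  have "continuous_on {0..T} A"
    using A by (rule continuous_on_subset) auto
  then have "continuous_on {0..T} (g j)"
    unfolding g_def by (intro continuous_intros cont_y)
  then have "((\<lambda>s. y 0 $ j + integral {0..s} (g j)) has_vector_derivative 0 + g j t) (at t within {0..T})"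
    by (intro has_vector_derivative_add has_vector_derivative_const integral_has_vector_derivative)
      (auto simp: T_def t)
  then have "((\<lambda>s. y s $ j) has_vector_derivative g j t) (at t within {0..T})"
    unfolding add_0_left
    by (rule has_vector_derivative_transform[rotated -1]) (auto intro: y simp: T_def t)
  moreover have "at t within {0..T} = at t within {0..}"
    by (rule at_within_nhd[of _ "{..<T}"]) (auto simp: T_def t)
  ultimately show "((\<lambda>s. y s $ j) has_vector_derivative (A t *v y t + a) $ j) (at t within {0..})"
    by (simp add: g_def matrix_vector_mult_def)
qed

section \<open>Frobenius inner products with block columns and Gram matrices\<close>

lemma inner_col_cons: "col_cons u G \<bullet> col_cons v H = u \<bullet> v + G \<bullet> H"
  unfolding inner_vec_def col_cons_def
  by (simp add: UNIV_option_conv sum.reindex sum.distrib)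

text \<open>The triple sum is the shape in which the sum of squares of the components of \<eta>
  expands in products of components of \<xi>.\<close>

lemma transpose_mult_self_inner:
  fixes F :: "real ^ 'n::finite ^ 'v::finite"
  shows "(transpose F ** F) \<bullet> G = (\<Sum>i\<in>UNIV. \<Sum>j\<in>UNIV. \<Sum>k\<in>UNIV. F $ i $ j * F $ i $ k * G $ j $ k)"
proof -
  have "(transpose F ** F) \<bullet> G = (\<Sum>j\<in>UNIV. \<Sum>k\<in>UNIV. \<Sum>i\<in>UNIV. F $ i $ j * F $ i $ k * G $ j $ k)"
    by (simp add: inner_vec_def matrix_matrix_mult_def transpose_def sum_distrib_right)
  also have "\<dots> = (\<Sum>j\<in>UNIV. \<Sum>i\<in>UNIV. \<Sum>k\<in>UNIV. F $ i $ j * F $ i $ k * G $ j $ k)"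
    by (intro sum.cong refl sum.swap)
  also have "\<dots> = (\<Sum>i\<in>UNIV. \<Sum>j\<in>UNIV. \<Sum>k\<in>UNIV. F $ i $ j * F $ i $ k * G $ j $ k)"
    by (rule sum.swap)
  finally show ?thesis .
qed

text \<open>The Gram matrix is symmetric, so the two cross terms of the mean square contribute
  equally.\<close>

lemma transpose_mult_self_inner_transpose:
  fixes F :: "real ^ 'n::finite ^ 'v::finite"
  shows "(transpose F ** F) \<bullet> transpose G = (transpose F ** F) \<bullet> G"
  unfolding transpose_mult_self_inner
  by (rule sum.cong[OF refl], subst sum.swap) (simp add: transpose_def mult.commute)

section \<open>Mean-square deviation and the linear ODE\<close>

theorem theorem1:
  fixes ten :: "'a::complex_hilbert \<Rightarrow> 'f::complex_hilbert \<Rightarrow> 'h::complex_hilbert"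
    and e :: "(real \<Rightarrow> complex ^ 'c) \<Rightarrow> 'f"
    and W :: "'c::finite \<times> 2 \<Rightarrow> real \<Rightarrow> 'f \<rightharpoonup> 'f"
    and \<rho>0 :: "'a \<Rightarrow> 'a" and \<rho> :: "'h \<Rightarrow> 'h"
    and X :: "real \<Rightarrow> 'n::finite \<Rightarrow> 'h \<Rightarrow> 'h" and X0 :: "'n \<Rightarrow> 'a \<Rightarrow> 'a"
    and \<alpha> :: "real ^ 'n ^ 'n" and \<beta> :: "complex ^ 'n ^ 'n ^ 'n"
    and \<Theta> \<gamma> :: "real ^ 'n ^ 'n ^ 'n"
    and U :: "real \<Rightarrow> real ^ 'r"
    and Es :: "real ^ 'n" and K :: "real ^ 'r ^ 'n"
    and M :: "real ^ 'n ^ ('c \<times> 2)" and N :: "real ^ ('c \<times> 2)"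
    and As :: "real ^ 'n ^ 'n" and A :: "real \<Rightarrow> real ^ 'n ^ 'n" and b :: "real ^ 'n"
    and \<mu> :: "real \<Rightarrow> real ^ 'n" and P :: "real ^ 'n ^ 'n" and Q :: "real \<Rightarrow> real ^ 'n ^ 'n"
    and \<xi> :: "real \<Rightarrow> 'n \<Rightarrow> 'h \<Rightarrow> 'h"
    and F :: "real ^ 'n ^ 'v" and \<eta> :: "real \<Rightarrow> 'v \<Rightarrow> 'h \<Rightarrow> 'h"
    and \<Sigma> :: "real ^ 'n ^ 'n" and \<Delta> :: "real \<Rightarrow> complex"
    and z :: "real \<Rightarrow> real ^ ('n option) ^ 'n" and z0 :: "real ^ ('n option) ^ 'n"
    and \<sigma> :: "real ^ 'n" and R :: "real ^ ('n option) ^ 'n" and d :: real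
    and c :: "real ^ ('n option) ^ 'n"
  assumes initial_space: "finite_cdim TYPE('a)"
    and tensor: "hilbert_tensor ten"
    and fock: "symmetric_fock_space e"
    and wiener: "quantum_wiener_process e W"
    and rho0: "density_operator \<rho>0"
    and rho: "is_tensor_op ten \<rho>0 (vacuum_state e) \<rho>"
    and alpha: "transpose \<alpha> = \<alpha>"
    and beta: "\<forall>j k l. \<beta> $ j $ k $ l = cnj (\<beta> $ k $ j $ l)"
    and Theta: "\<Theta> = (\<chi> j k l. Im (\<beta> $ j $ k $ l))"
    and gamma: "\<gamma> = (\<chi> j k l. Re (\<beta> $ j $ k $ l))"
    and X0: "\<forall>k. selfadjoint (X0 k)"
    and X_init: "\<forall>k. is_tensor_op ten (X0 k) id (X 0 k)"
    and X_selfadjoint: "\<forall>t\<ge>0. \<forall>k. selfadjoint (X t k)"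
    and X_algebra: "\<forall>t\<ge>0. \<forall>j k \<psi>. X t j (X t k \<psi>) =
        \<alpha> $ j $ k *\<^sub>R \<psi> + (\<Sum>l\<in>UNIV. \<beta> $ j $ k $ l *\<^sub>C X t l \<psi>)"
    and U: "continuous_on {0..} U"
    and b: "b = 2 *\<^sub>R (section_row \<Theta> *v vec_stack (transpose M ** J_mat ** M ** \<alpha>))"
    and As: "As = 2 *\<^sub>R (\<Theta> \<diamondop> (Es + (transpose M ** J_mat) *v N)) +
        2 *\<^sub>R (\<Sum>l\<in>UNIV. array_section \<Theta> l ** transpose M **
          (M ** \<Theta> $ l + J_mat ** M ** \<gamma> $ l))"
    and A: "\<And>t. A t = As + (\<Sum>k\<in>UNIV. U t $ k *\<^sub>R (2 *\<^sub>R (\<Theta> \<diamondop> column k K)))"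
    and X_qsde: "qsde ten e W
        (\<lambda>t j \<psi>. (\<Sum>k\<in>UNIV. A t $ j $ k *\<^sub>R X t k \<psi>) + b $ j *\<^sub>R \<psi>)
        (\<lambda>t j k \<psi>. 2 *\<^sub>R (\<Sum>i\<in>UNIV. M $ k $ i *\<^sub>R (\<Sum>l\<in>UNIV. \<Theta> $ j $ i $ l *\<^sub>R X t l \<psi>)))
        X"
    and mu: "\<And>t. \<mu> t = (\<chi> k. Re (expectation \<rho> (X t k)))"
    and P: "P = (\<chi> j k. Re (expectation \<rho> (X 0 j \<circ> X 0 k)))"
    and xi: "\<And>t. \<xi> t = (\<lambda>j \<psi>. X t j \<psi> - X 0 j \<psi>)"
    and Q: "\<And>t. Q t = (\<chi> j k. Re (expectation \<rho> (\<xi> t j \<circ> X 0 k)))"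
    and F: "rank F = CARD('v)"
    and eta: "\<And>t. \<eta> t = (\<lambda>i \<psi>. \<Sum>j\<in>UNIV. F $ i $ j *\<^sub>R \<xi> t j \<psi>)"
    and Sigma: "\<Sigma> = transpose F ** F"
    and Delta: "\<And>t. \<Delta> t = expectation \<rho> (\<lambda>\<psi>. \<Sum>i\<in>UNIV. \<eta> t i (\<eta> t i \<psi>))"
    and z: "\<And>t. z t = col_cons (\<mu> t) (P + Q t)"
    and z0: "z0 = col_cons (\<mu> 0) P"
    and sigma: "\<sigma> = (\<chi> l. \<Sigma> \<bullet> array_section \<gamma> l)"
    and R: "R = col_cons \<sigma> (- 2 *\<^sub>R \<Sigma>)"
    and d: "d = 2 * (\<Sigma> \<bullet> P) - \<sigma> \<bullet> \<mu> 0"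
    and c: "c = outer b (vec_cons 1 (\<mu> 0))"
  shows "(\<forall>t\<ge>0. (\<forall>k. expectation \<rho> (X t k) = of_real (\<mu> t $ k)) \<and>
            \<Delta> t = of_real (R \<bullet> z t + d) \<and>
            \<Delta> t = of_real (R \<bullet> (z t - z0)) \<and>
            (z has_vector_derivative (A t ** z t + c)) (at t within {0..})) \<and>
         z 0 = z0"
proof -
  note bcD = bounded_clinear_D
  obtain B r where B: "finite B" and r: "\<And>u v. r v u = cnj (r u v)"
    and expect: "\<And>\<zeta>. bounded_clinear \<zeta> \<Longrightarrow>
      expectation \<rho> \<zeta> = matrix_expectation ten (e (\<lambda>_. 0)) B r \<zeta>"
    and one: "matrix_expectation ten (e (\<lambda>_. 0)) B r (\<lambda>\<psi>. \<psi>) = 1"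
    by (rule expectation_as_matrix_expectation[OF initial_space tensor rho0
          rho[unfolded vacuum_state_def[abs_def]] fock_cinner[OF fock zero_in_L2]]) (rule that)
  define E where "E = matrix_expectation ten (e (\<lambda>_. 0)) B r"
  note E_simps = matrix_expectation_simps[of ten "e (\<lambda>_. 0)" B r, folded E_def]
    matrix_expectation_sum[of ten "e (\<lambda>_. 0)" B r, folded E_def] one[folded E_def]
  note E_adjoint = matrix_expectation_adjoint[of r, OF r, where ten = ten and \<Omega> = "e (\<lambda>_. 0)" and B = B, folded E_def]
  have X: "bounded_clinear (X t k)" and X_adj: "cinner (X t k \<phi>) \<psi> = cinner \<phi> (X t k \<psi>)"
    if "0 \<le> t" for t k \<phi> \<psi>
    using X_selfadjoint that unfolding selfadjoint_def by blast+
  have \<xi>: "bounded_clinear (\<xi> t k)" if "0 \<le> t" for t k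
    unfolding xi using that by (intro bounded_clinear_diff X) auto
  have \<eta>: "bounded_clinear (\<eta> t i)" if "0 \<le> t" for t i
    unfolding eta using that by (intro bounded_clinear_sum bounded_clinear_scaleR \<xi>)
  \<comment> \<open>This is the form required of \<open>Z\<close> in
    \<open>qsde_vacuum_expectation\<close>.\<close>
  have X_vac: "X 0 k (ten v (e (\<lambda>_. 0))) = ten (X0 k v) (e (\<lambda>_. 0))" for k v
    using X_init unfolding is_tensor_op_def by simp

  have E_real: "E (X t k) = of_real (\<mu> t $ k)" if "0 \<le> t" for t k
  proof -
    have "E (X t k) = cnj (E (X t k))"
      by (rule E_adjoint) (rule X_adj[OF that])
    then have "Im (E (X t k)) = 0"
      by (metis Reals_cnj_iff complex_is_Real_iff)
    then show ?thesis
      by (simp add: mu expect[OF X[OF that], folded E_def] complex_eq_iff)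
  qed

  \<comment> \<open>The real correlation matrix of \<open>X t\<close> with the initial variables.
    Unlike \<open>Q\<close> it does not involve \<xi>; it equals \<open>P + Q t\<close> and obeys a
    linear equation directly.\<close>
  define V where "V = (\<lambda>t. \<chi> j k. Re (E (\<lambda>\<psi>. X t j (X 0 k \<psi>))))"
  have P_V: "P = V 0"
    unfolding P V_def o_def using bounded_clinear_comp[OF X X, of 0 0]
    by (simp add: expect[folded E_def])
  have PQ: "P + Q t = V t" if "0 \<le> t" for t
  proof -
    have "expectation \<rho> (\<xi> t j \<circ> X 0 k) = E (\<lambda>\<psi>. X t j (X 0 k \<psi>)) - E (\<lambda>\<psi>. X 0 j (X 0 k \<psi>))" for j k
      using expect[OF bounded_clinear_comp[OF \<xi> X], folded E_def, of t 0 j k] that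
      by (simp add: o_def xi E_simps)
    then show ?thesis
      unfolding P_V V_def Q by (simp add: vec_eq_iff)
  qed

  \<comment> \<open>The real second-moment matrix of \<open>X t\<close> after reduction by the
    algebraic relations. Since the mean is real, only the real part \<gamma> of \<beta>
    contributes.\<close>
  define H where "H = (\<lambda>t. \<alpha> + (\<chi> j k. \<Sum>l\<in>UNIV. \<gamma> $ j $ k $ l * \<mu> t $ l))"
  have H: "Re (E (\<lambda>\<psi>. X t j (X t k \<psi>))) = H t $ j $ k" if "0 \<le> t" for t j k
    using that by (simp add: X_algebra E_simps E_real H_def gamma)
  have P_H: "P = H 0"
    unfolding P_V V_def by (simp add: H vec_eq_iff)
  have Sigma_H: "\<Sigma> \<bullet> H t = \<Sigma> \<bullet> \<alpha> + \<sigma> \<bullet> \<mu> t" for t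
  proof -
    have "\<Sigma> \<bullet> (\<chi> j k. \<Sum>l\<in>UNIV. \<gamma> $ j $ k $ l * \<mu> t $ l) =
        \<Sigma> \<bullet> (\<Sum>l\<in>UNIV. \<mu> t $ l *\<^sub>R array_section \<gamma> l)"
      by (rule arg_cong[where f = "(\<bullet>) \<Sigma>"]) (simp add: vec_eq_iff array_section_def mult.commute)
    also have "\<dots> = \<sigma> \<bullet> \<mu> t"
      by (simp add: inner_sum_right sigma inner_vec_def[of _ "\<mu> t"] mult.commute)
    finally show ?thesis
      unfolding H_def by (simp add: inner_add_right)
  qed

  \<comment> \<open>The product of two deviations has four terms. The one with the initial variable
    on the left is the adjoint of one with it on the right, hence the transpose of
    \<open>V t\<close>.\<close>
  have Re_\<xi>: "Re (E (\<lambda>\<psi>. \<xi> t j (\<xi> t k \<psi>))) =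
      (H t - V t - transpose (V t) + P) $ j $ k" if t: "0 \<le> t" for t j k
  proof -
    have "E (\<lambda>\<psi>. X 0 j (X t k \<psi>)) = cnj (E (\<lambda>\<psi>. X t k (X 0 j \<psi>)))"
      by (rule E_adjoint) (simp add: X_adj t)
    then have "Re (E (\<lambda>\<psi>. X 0 j (X t k \<psi>))) = V t $ k $ j"
      by (simp add: V_def)
    moreover have "(\<lambda>\<psi>. \<xi> t j (\<xi> t k \<psi>)) = (\<lambda>\<psi>. X t j (X t k \<psi>) - X t j (X 0 k \<psi>) -
        (X 0 j (X t k \<psi>) - X 0 j (X 0 k \<psi>)))"
      unfolding xi by (simp add: bcD(4)[OF X] t)
    ultimately show ?thesis
      by (simp add: E_simps H t V_def P_V transpose_def)
  qed

  have \<Delta>: "\<Delta> t = of_real (\<Sigma> \<bullet> (H t - V t - transpose (V t) + P))" if t: "0 \<le> t" for t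
  proof -
    have "bounded_clinear (\<lambda>\<psi>. \<Sum>i\<in>UNIV. \<eta> t i (\<eta> t i \<psi>))"
      by (rule bounded_clinear_sum) (rule bounded_clinear_comp[OF \<eta>[OF t] \<eta>[OF t]])
    then have \<Delta>_E: "\<Delta> t = (\<Sum>i\<in>UNIV. E (\<lambda>\<psi>. \<eta> t i (\<eta> t i \<psi>)))"
      by (simp add: Delta expect E_def[symmetric] E_simps)
    have \<eta>_adj: "cinner (\<eta> t i \<phi>) \<psi> = cinner \<phi> (\<eta> t i \<psi>)" for i \<phi> \<psi>
    proof -
      have "cinner (\<xi> t j \<phi>) \<psi> = cinner \<phi> (\<xi> t j \<psi>)" for j \<phi> \<psi>
        unfolding xi by (simp add: cinner_simps_left cinner_simps_right X_adj t)
      then show ?thesis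
        unfolding eta by (simp add: cinner_simps_left cinner_simps_right)
    qed
    have "E (\<lambda>\<psi>. \<eta> t i (\<eta> t i \<psi>)) = cnj (E (\<lambda>\<psi>. \<eta> t i (\<eta> t i \<psi>)))" for i
      by (rule E_adjoint) (simp add: \<eta>_adj)
    \<comment> \<open>Expectations are complex numbers, so \<Delta> has to be shown real before it
      can be replaced by its real part.\<close>
    then have "cnj (\<Delta> t) = \<Delta> t"
      unfolding \<Delta>_E by simp
    then have "\<Delta> t = of_real (Re (\<Delta> t))"
      by (simp add: complex_eq_iff)
    also have "Re (\<Delta> t) = (\<Sum>i\<in>UNIV. \<Sum>j\<in>UNIV. \<Sum>k\<in>UNIV. F $ i $ j * F $ i $ k *
        Re (E (\<lambda>\<psi>. \<xi> t j (\<xi> t k \<psi>))))"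
      unfolding \<Delta>_E eta
      by (simp add: bcD(5,6)[OF \<xi>[OF t]] E_simps sum_distrib_left mult.assoc)
    also have "\<dots> = \<Sigma> \<bullet> (H t - V t - transpose (V t) + P)"
      unfolding Re_\<xi>[OF t] Sigma transpose_mult_self_inner ..
    finally show ?thesis .
  qed
  \<comment> \<open>Comparing \<open>H t\<close> with \<open>H 0 = P\<close> eliminates \<alpha> and
    leaves the constant \<open>\<Sigma> \<bullet> P - \<sigma> \<bullet> \<mu> 0\<close>; the
    separate summand \<open>P\<close> adds another \<open>\<Sigma> \<bullet> P\<close>, which makes
    \<open>d\<close>. The cross terms give the block \<open>-2\<close> times \<Sigma> of
    \<open>R\<close>.\<close>
  have \<Delta>_z: "\<Sigma> \<bullet> (H t - V t - transpose (V t) + P) = R \<bullet> z t + d" if "0 \<le> t" for t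
  proof -
    have "\<Sigma> \<bullet> transpose (V t) = \<Sigma> \<bullet> V t"
      unfolding Sigma by (rule transpose_mult_self_inner_transpose)
    moreover have "\<Sigma> \<bullet> H t = \<Sigma> \<bullet> P - \<sigma> \<bullet> \<mu> 0 + \<sigma> \<bullet> \<mu> t"
      using Sigma_H[of t] Sigma_H[of 0] unfolding P_H by simp
    ultimately show ?thesis
      unfolding R z d PQ[OF that] inner_col_cons by (simp add: inner_add_right inner_diff_right)
  qed
  have z_0: "z 0 = z0"
    unfolding z z0 using PQ[of 0] P_V by simp
  have d_z0: "d = - (R \<bullet> z0)"
    unfolding d R z0 inner_col_cons by simp

  have "continuous_on {0..} (\<lambda>t. As + (\<Sum>k\<in>UNIV. U t $ k *\<^sub>R (2 *\<^sub>R (\<Theta> \<diamondop> column k K))))"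
    by (intro continuous_intros U)
  then have contA: "continuous_on {0..} A"
    unfolding A .
  \<comment> \<open>Applying the drift after \<open>Z\<close> and taking expectations gives a closed
    linear equation whose inhomogeneity is \<open>b\<close> weighted by the expectation of
    \<open>Z\<close>: 1 for the identity, \<open>\<mu> 0 $ l\<close> for
    \<open>X 0 l\<close>.\<close>
  have ode: "((\<lambda>t. \<chi> j. Re (E (\<lambda>\<psi>. X t j (Z \<psi>)))) has_vector_derivative
      A t *v (\<chi> j. Re (E (\<lambda>\<psi>. X t j (Z \<psi>)))) + Re (E Z) *\<^sub>R b) (at t within {0..})"
    if t: "0 \<le> t" and Z: "\<And>v. Z (ten v (e (\<lambda>_. 0))) = ten (Z0 v) (e (\<lambda>_. 0))" for t Z Z0
  proof (rule integral_equation_imp_ode[OF _ contA t])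
    fix t :: real and j assume t: "0 \<le> t"
    show "((\<lambda>s. (\<Sum>k\<in>UNIV. A s $ j $ k * (\<chi> j. Re (E (\<lambda>\<psi>. X s j (Z \<psi>)))) $ k) + (Re (E Z) *\<^sub>R b) $ j)
        has_integral ((\<chi> j. Re (E (\<lambda>\<psi>. X t j (Z \<psi>)))) $ j - (\<chi> j. Re (E (\<lambda>\<psi>. X 0 j (Z \<psi>)))) $ j)) {0..t}"
      using has_integral_linear[OF qsde_vacuum_expectation[OF tensor fock wiener X_qsde t, of Z Z0 B r j, OF Z B,
            folded E_def] bounded_linear_Re]
      by (simp add: E_simps o_def mult.commute)
  qed
  have mean_ode: "(\<mu> has_vector_derivative A t *v \<mu> t + b) (at t within {0..})" if t: "0 \<le> t" for t
  proof -
    have \<mu>_E: "\<mu> s = (\<chi> j. Re (E (\<lambda>\<psi>. X s j \<psi>)))" if "0 \<le> s" for s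
      using E_real[OF that] by (simp add: vec_eq_iff)
    show ?thesis
      using ode[OF t, of "\<lambda>\<psi>. \<psi>" "\<lambda>v. v"] t unfolding \<mu>_E[OF t]
      by (intro has_vector_derivative_transform[of _ _ \<mu>, rotated -1]) (simp_all add: \<mu>_E E_simps)
  qed
  have V_ode: "((\<lambda>t. \<chi> j. V t $ j $ l) has_vector_derivative A t *v (\<chi> j. V t $ j $ l) + \<mu> 0 $ l *\<^sub>R b)
      (at t within {0..})" if t: "0 \<le> t" for t l
    using ode[of t "X 0 l" "X0 l", OF t X_vac] by (simp add: V_def E_real)
  have "(z has_vector_derivative (A t ** z t + c)) (at t within {0..})" if t: "0 \<le> t" for t
  proof (intro has_vector_derivative_vecI)
    fix i l
    have comp: "((\<lambda>s. y s $ i) has_vector_derivative y' $ i) (at t within {0..})"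
      if "(y has_vector_derivative y') (at t within {0..})" for y :: "real \<Rightarrow> real ^ 'n" and y'
      by (rule bounded_linear.has_vector_derivative[OF bounded_linear_vec_nth that])
    show "((\<lambda>s. z s $ i $ l) has_vector_derivative (A t ** z t + c) $ i $ l) (at t within {0..})"
    \<comment> \<open>Column \<open>None\<close> of \<open>z\<close> is the mean and column
      \<open>Some k\<close> is column \<open>k\<close> of \<open>V\<close>; the matching columns of
      \<open>c\<close> are \<open>b\<close> and \<open>b\<close> scaled by
      \<open>\<mu> 0 $ k\<close>.\<close>
    proof (cases l)
      case None
      then show ?thesis
        using comp[OF mean_ode[OF t]]
        by (simp add: z c col_cons_def outer_def vec_cons_def matrix_matrix_mult_def matrix_vector_mult_def)
    next
      case (Some k)
      then have "(A t ** z t + c) $ i $ l = (A t *v (\<chi> j. V t $ j $ k) + \<mu> 0 $ k *\<^sub>R b) $ i"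
        using PQ[OF t] by (simp add: z c col_cons_def outer_def vec_cons_def matrix_matrix_mult_def
            matrix_vector_mult_def mult.commute)
      \<comment> \<open>The identification with \<open>V\<close> is available at nonnegative times
        only, which suffices for the derivative within the half-line.\<close>
      moreover have "z s $ i $ l = (\<chi> j. V s $ j $ k) $ i" if "0 \<le> s" for s
        using PQ[OF that] Some by (simp add: z col_cons_def)
      ultimately show ?thesis
        using comp[OF V_ode[OF t, of k]] t
        by (intro has_vector_derivative_transform[of _ _ "\<lambda>s. z s $ i $ l" "\<lambda>s. (\<chi> j. V s $ j $ k) $ i"]) auto
    qed
  qed
  then show ?thesis
    using E_real expect[OF X, folded E_def] \<Delta> \<Delta>_z z_0 d_z0 by (simp add: inner_diff_right)
qed

end
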